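(* Let $\mathcal{S}$ be Thompson's semigroup. Then $$H^{1}(\mathfrak{B}(\mathcal{S}),\mathfrak{B}(\mathcal{S}))\cong\frac{\mathcal{M}(\mathcal{S})}{\mathfrak{B}(\mathcal{S})}$$ as vector spaces, where $\mathcal{M}(\mathcal{S})=\{T\in\mathcal{L}(\mathcal{S}) : TA-AT\in\mathfrak{B}(\mathcal{S})\text{ for every }A\in\mathfrak{B}(\mathcal{S})\}$.
   Context: Thompson's semigroup $\mathcal{S}$ is the discrete cancellative semigroup with unit $e$ given by the presentation $\mathcal{S}=\langle X_0,X_1,X_2,\ldots \mid X_jX_i=X_iX_{j+1},\ j>i\rangle$. $l^2(\mathcal{S})$ is the Hilbert space of square-summable complex functions on $\mathcal{S}$ with orthonormal basis $(\delta_s)_{s\in\mathcal{S}}$. For $f,g\in l^2(\mathcal{S})$ put $(f*g)(s)=\sum_{uv=s}f(u)g(v)$ and $L_fg=f*g$. $\mathcal{L}(\mathcal{S})$ is the algebra of all left convolution operators $L_f$ ($f\in l^2(\mathcal{S})$) that are bounded operators on $l^2(\mathcal{S})$. Write $L_s=L_{\delta_s}$. $\mathfrak{B}(\mathcal{S})\subseteq\mathcal{L}(\mathcal{S})$ is the Banach algebra generated by $\{L_s:s\in\mathcal{S}\}$ in $B(l^2(\mathcal{S}))$ (norm-closed subalgebra). $\mathcal{M}(\mathcal{S})$ is a norm-closed linear subspace of $\mathcal{L}(\mathcal{S})$ containing $\mathfrak{B}(\mathcal{S})$. For a Banach algebra $\mathcal{A}$ and a Banach $\mathcal{A}$-bimodule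 $X$, a derivation is a linear map $D:\mathcal{A}\to X$ with $D(AB)=AD(B)+D(A)B$ for all $A,B\in\mathcal{A}$; it is inner if there is $T\in X$ with $D(A)=AT-TA$ for all $A\in\mathcal{A}$. $H^1(\mathcal{A},X)$ is the quotient vector space of the space of all continuous derivations from $\mathcal{A}$ into $X$ by the subspace of inner derivations. *)

theory Defs
  imports "HOL-Analysis.Analysis" "HOL-Library.Function_Algebras"
begin

section \<open>Thompson's semigroup\<close>

text \<open>A word \<open>[i\<^sub>1, \<dots>, i\<^sub>n]\<close> stands for the product of the generators with these indices.\<close>

inductive thompson_step :: "nat list \<Rightarrow> nat list \<Rightarrow> bool" where
  "i < j \<Longrightarrow> thompson_step (us @ [j, i] @ vs) (us @ [i, j + 1] @ vs)"

lemma thompson_step_append: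
  assumes "thompson_step x y"
  shows "thompson_step (us @ x @ vs) (us @ y @ vs)"
  using assms
proof cases
  case (1 i j us' vs')
  then show ?thesis
    using thompson_step.intros[of i j "us @ us'" "vs' @ vs"] by simp
qed

lemma equivclp_thompson_step_append:
  assumes "equivclp thompson_step x y"
  shows "equivclp thompson_step (us @ x @ vs) (us @ y @ vs)"
  using assms
proof (induction rule: equivclp_induct)
  case base
  show ?case by simp
next
  case (step y z)
  from step.hyps(2) have
    "thompson_step (us @ y @ vs) (us @ z @ vs) \<or> thompson_step (us @ z @ vs) (us @ y @ vs)"
    by (auto intro: thompson_step_append)
  with step.IH show ?case
    by (rule equivclp_into_equivclp)
qed

quotient_type thompson = "nat list" / "equivclp thompson_step"
  by (rule equivp_evquivclp)

instantiation thompson :: monoid_mult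
begin

lift_definition one_thompson :: thompson is "[]" .

lift_definition times_thompson :: "thompson \<Rightarrow> thompson \<Rightarrow> thompson" is "(@)"
  by (metis append.assoc append_Nil append_Nil2 equivclp_thompson_step_append equivclp_trans)

instance
  by standard (transfer; simp)+

end

lift_definition thompson_gen :: "nat \<Rightarrow> thompson" is "\<lambda>i. [i]" .

lemma thompson_gen_relation:
  "i < j \<Longrightarrow> thompson_gen j * thompson_gen i = thompson_gen i * thompson_gen (j + 1)"
  by transfer (use thompson_step.intros[of _ _ "[]" "[]"] in auto)

section \<open>The Hilbert space of square-summable complex functions\<close>

typedef 'a ell2 = "{f :: 'a \<Rightarrow> complex. (\<lambda>x. (cmod (f x))\<^sup>2) summable_on UNIV}"
  by (rule exI[of _ "\<lambda>_. 0"]) simp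

setup_lifting type_definition_ell2

lemma square_summable_inner:
  fixes f g :: "'a \<Rightarrow> complex"
  assumes "(\<lambda>x. (cmod (f x))\<^sup>2) summable_on UNIV" "(\<lambda>x. (cmod (g x))\<^sup>2) summable_on UNIV"
  shows "(\<lambda>x. f x \<bullet> g x) summable_on UNIV"
proof -
  have "(\<lambda>x. norm (f x \<bullet> g x)) summable_on UNIV"
  proof (rule Infinite_Sum.abs_summable_on_comparison_test')
    show "(\<lambda>x. (cmod (f x))\<^sup>2 + (cmod (g x))\<^sup>2) summable_on UNIV"
      using assms by (rule summable_on_add)
    fix x
    have "\<bar>f x \<bullet> g x\<bar> \<le> cmod (f x) * cmod (g x)"
      by (rule Cauchy_Schwarz_ineq2)
    also have "\<dots> \<le> 2 * (cmod (f x) * cmod (g x))"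
      by simp
    also have "\<dots> \<le> (cmod (f x))\<^sup>2 + (cmod (g x))\<^sup>2"
      using sum_squares_bound[of "cmod (f x)" "cmod (g x)"] by (simp add: mult.assoc)
    finally show "norm (f x \<bullet> g x) \<le> (cmod (f x))\<^sup>2 + (cmod (g x))\<^sup>2"
      by simp
  qed
  then show ?thesis
    by (rule Infinite_Sum.abs_summable_summable)
qed

lemma square_summable_add:
  fixes f g :: "'a \<Rightarrow> complex"
  assumes "(\<lambda>x. (cmod (f x))\<^sup>2) summable_on UNIV" "(\<lambda>x. (cmod (g x))\<^sup>2) summable_on UNIV"
  shows "(\<lambda>x. (cmod (f x + g x))\<^sup>2) summable_on UNIV"
proof -
  have eq: "(\<lambda>x. (cmod (f x + g x))\<^sup>2)
      = (\<lambda>x. (cmod (f x))\<^sup>2 + (cmod (g x))\<^sup>2 + 2 * (f x \<bullet> g x))"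
    by (simp add: power2_norm_eq_inner inner_add_left inner_add_right inner_commute fun_eq_iff)
  show ?thesis
    unfolding eq by (intro summable_on_add summable_on_cmult_right square_summable_inner assms)
qed

lemma square_summable_scale:
  fixes f :: "'a \<Rightarrow> complex"
  assumes "(\<lambda>x. (cmod (f x))\<^sup>2) summable_on UNIV"
  shows "(\<lambda>x. (cmod (c * f x))\<^sup>2) summable_on UNIV"
  using summable_on_cmult_right[OF assms, of "(cmod c)\<^sup>2"]
  by (simp add: norm_mult power_mult_distrib)

lift_definition ell2_delta :: "'a \<Rightarrow> 'a ell2" is "\<lambda>s t. if t = s then 1 else 0"
proof -
  fix s :: 'a
  show "(\<lambda>t. (cmod (if t = s then 1 else 0))\<^sup>2) summable_on UNIV"
    by (rule summable_on_cong_neutral[THEN iffD1, OF _ _ _ summable_on_finite[of "{s}"]]) auto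
qed

lift_definition ell2_scale :: "complex \<Rightarrow> 'a ell2 \<Rightarrow> 'a ell2" is "\<lambda>c f x. c * f x"
  by (rule square_summable_scale)

text \<open>
  The distribution has no complex normed spaces. Hence \<open>'a ell2\<close> is made an instance of
  \<^class>\<open>real_inner\<close> through the real part of its complex inner product (the inner product of
  \<^typ>\<open>complex\<close> is the real part of the hermitian one), which yields the usual norm; the complex
  scalar multiplication is \<^const>\<open>ell2_scale\<close>.
\<close>

instantiation ell2 :: (type) real_inner
begin

lift_definition zero_ell2 :: "'a ell2" is "\<lambda>_. 0"
  by simp

lift_definition plus_ell2 :: "'a ell2 \<Rightarrow> 'a ell2 \<Rightarrow> 'a ell2" is "\<lambda>f g x. f x + g x"
  by (rule square_summable_add)

lift_definition uminus_ell2 :: "'a ell2 \<Rightarrow> 'a ell2" is "\<lambda>f x. - f x"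
  by simp

definition minus_ell2 :: "'a ell2 \<Rightarrow> 'a ell2 \<Rightarrow> 'a ell2" where
  "minus_ell2 f g = f + - g"

definition scaleR_ell2 :: "real \<Rightarrow> 'a ell2 \<Rightarrow> 'a ell2" where
  "scaleR_ell2 r f = ell2_scale (complex_of_real r) f"

lift_definition inner_ell2 :: "'a ell2 \<Rightarrow> 'a ell2 \<Rightarrow> real" is "\<lambda>f g. \<Sum>\<^sub>\<infinity>x. f x \<bullet> g x" .

definition norm_ell2 :: "'a ell2 \<Rightarrow> real" where
  "norm_ell2 f = sqrt (f \<bullet> f)"

definition sgn_ell2 :: "'a ell2 \<Rightarrow> 'a ell2" where
  "sgn_ell2 f = inverse (norm f) *\<^sub>R f"

definition dist_ell2 :: "'a ell2 \<Rightarrow> 'a ell2 \<Rightarrow> real" where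
  "dist_ell2 f g = norm (f - g)"

definition uniformity_ell2 :: "('a ell2 \<times> 'a ell2) filter" where
  "uniformity_ell2 = (INF e\<in>{0<..}. principal {(x, y). dist x y < e})"

definition open_ell2 :: "'a ell2 set \<Rightarrow> bool" where
  "open_ell2 U \<longleftrightarrow> (\<forall>x\<in>U. eventually (\<lambda>(x', y). x' = x \<longrightarrow> y \<in> U) uniformity)"

instance
proof
  fix a b c :: "'a ell2" and r s :: real
  show "a + b + c = a + (b + c)" "a + b = b + a" "0 + a = a" "- a + a = 0"
    by (transfer; simp add: add_ac)+
  show "a - b = a + - b"
    by (simp add: minus_ell2_def)
  show "r *\<^sub>R (a + b) = r *\<^sub>R a + r *\<^sub>R b" "(r + s) *\<^sub>R a = r *\<^sub>R a + s *\<^sub>R a"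
    "r *\<^sub>R s *\<^sub>R a = (r * s) *\<^sub>R a" "1 *\<^sub>R a = a"
    unfolding scaleR_ell2_def by (transfer; simp add: algebra_simps)+
  show "a \<bullet> b = b \<bullet> a"
    by transfer (simp add: inner_commute)
  show "(a + b) \<bullet> c = a \<bullet> c + b \<bullet> c"
    by transfer (simp add: inner_add_left infsum_add square_summable_inner)
  show "(r *\<^sub>R a) \<bullet> b = r * (a \<bullet> b)"
    unfolding scaleR_ell2_def
    by transfer (simp flip: scaleR_conv_of_real infsum_cmult_right')
  show "0 \<le> a \<bullet> a"
    by transfer (simp add: infsum_nonneg)
  show "a \<bullet> a = 0 \<longleftrightarrow> a = 0"
  proof (transfer, safe)
    fix f :: "'a \<Rightarrow> complex"
    assume f: "(\<lambda>x. (cmod (f x))\<^sup>2) summable_on UNIV" and 0: "(\<Sum>\<^sub>\<infinity>x. f x \<bullet> f x) = 0"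
    have "f x \<bullet> f x = 0" for x
      using nonneg_infsum_le_0D[of "\<lambda>x. f x \<bullet> f x" UNIV x] square_summable_inner[OF f f] 0
      by simp
    then show "f = (\<lambda>_. 0)"
      by auto
  qed simp
qed (simp_all add: norm_ell2_def sgn_ell2_def dist_ell2_def uniformity_ell2_def open_ell2_def)

end

lemma norm_ell2_eq: "norm f = sqrt (\<Sum>\<^sub>\<infinity>x. (cmod (Rep_ell2 f x))\<^sup>2)"
  by (simp add: norm_ell2_def inner_ell2.rep_eq power2_norm_eq_inner)

section \<open>Bounded operators\<close>

type_synonym 'a ell2_op = "'a ell2 \<Rightarrow>\<^sub>L 'a ell2"

lemma bounded_linear_ell2_scale: "bounded_linear (ell2_scale c)"
proof
  fix x y :: "'a ell2" and r :: real
  show "ell2_scale c (x + y) = ell2_scale c x + ell2_scale c y"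
    by transfer (simp add: algebra_simps)
  show "ell2_scale c (r *\<^sub>R x) = r *\<^sub>R ell2_scale c x"
    unfolding scaleR_ell2_def by transfer (simp add: algebra_simps)
  have "norm (ell2_scale c f) = cmod c * norm f" for f :: "'a ell2"
    unfolding norm_ell2_eq ell2_scale.rep_eq
    by (simp add: norm_mult power_mult_distrib infsum_cmult_right' real_sqrt_mult)
  then show "\<exists>K. \<forall>f :: 'a ell2. norm (ell2_scale c f) \<le> norm f * K"
    by (metis mult.commute order_refl)
qed

definition op_scale :: "complex \<Rightarrow> 'a ell2_op \<Rightarrow> 'a ell2_op" where
  "op_scale c T = Blinfun (\<lambda>f. ell2_scale c (T f))"

lemma op_scale_apply [simp]: "op_scale c T f = ell2_scale c (T f)"
  unfolding op_scale_def
  by (simp add: bounded_linear_Blinfun_apply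
      bounded_linear_compose[OF bounded_linear_ell2_scale blinfun.bounded_linear_right])

text \<open>
  \<^typ>\<open>'a ell2_op\<close> consists of the bounded real-linear operators, whose norm is the operator norm.
\<close>

definition bounded_operators :: "'a ell2_op set" where
  "bounded_operators = {T :: 'a ell2_op. \<forall>c f. T (ell2_scale c f) = ell2_scale c (T f)}"

section \<open>Left convolution operators\<close>

definition convolution :: "('a::monoid_mult \<Rightarrow> complex) \<Rightarrow> ('a \<Rightarrow> complex) \<Rightarrow> 'a \<Rightarrow> complex" where
  "convolution f g s = (\<Sum>\<^sub>\<infinity>(u, v) \<in> {(u, v). u * v = s}. f u * g v)"

text \<open>
  \<open>is_left_convolution f T\<close> says that \<open>f * g\<close> is square-summable for all \<open>g\<close>, and that
  \<open>g \<mapsto> f * g\<close> is the bounded operator \<open>T\<close>.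
\<close>

definition is_left_convolution :: "'a::monoid_mult ell2 \<Rightarrow> 'a ell2_op \<Rightarrow> bool" where
  "is_left_convolution f T \<longleftrightarrow>
    T \<in> bounded_operators \<and> (\<forall>g. Rep_ell2 (T g) = convolution (Rep_ell2 f) (Rep_ell2 g))"

definition left_convolution_algebra :: "'a::monoid_mult ell2_op set" where
  "left_convolution_algebra = {T. \<exists>f. is_left_convolution f T}"

definition closed_subalgebra :: "'a ell2_op set \<Rightarrow> bool" where
  "closed_subalgebra A \<longleftrightarrow> A \<subseteq> bounded_operators \<and> closed A \<and> 0 \<in> A \<and>
    (\<forall>S\<in>A. \<forall>T\<in>A. S + T \<in> A) \<and> (\<forall>c. \<forall>T\<in>A. op_scale c T \<in> A) \<and> (\<forall>S\<in>A. \<forall>T\<in>A. S o\<^sub>L T \<in> A)"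

definition semigroup_banach_algebra :: "'a::monoid_mult ell2_op set" where
  "semigroup_banach_algebra =
    closed_subalgebra hull {T. \<exists>s. is_left_convolution (ell2_delta s) T}"

definition derivation_multipliers :: "'a::monoid_mult ell2_op set" where
  "derivation_multipliers = {T \<in> left_convolution_algebra.
    \<forall>A\<in>semigroup_banach_algebra. (T o\<^sub>L A) - (A o\<^sub>L T) \<in> semigroup_banach_algebra}"

section \<open>Complex vector spaces and their quotients\<close>

record 'v cvector_space =
  vcarrier :: "'v set"
  vadd :: "'v \<Rightarrow> 'v \<Rightarrow> 'v"
  vscale :: "complex \<Rightarrow> 'v \<Rightarrow> 'v"

text \<open>
  The quotient of a subspace \<open>V\<close> by a subspace \<open>W\<close>: the cosets \<open>v + W\<close> with \<open>v \<in> V\<close>. A scalar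
  multiple of a coset is \<open>c U + W\<close>, and not \<open>c U\<close>, because of \<open>c = 0\<close>.
\<close>

definition quotient_space ::
    "(complex \<Rightarrow> 'v \<Rightarrow> 'v) \<Rightarrow> 'v set \<Rightarrow> 'v set \<Rightarrow> 'v::ab_group_add set cvector_space" where
  "quotient_space sc V W =
    \<lparr>vcarrier = (\<lambda>v. v +o W) ` V,
     vadd = (\<lambda>U U'. U + U'),
     vscale = (\<lambda>c U. sc c ` U + W)\<rparr>"

definition cvector_space_isomorphic :: "'v cvector_space \<Rightarrow> 'w cvector_space \<Rightarrow> bool" where
  "cvector_space_isomorphic X Y \<longleftrightarrow>
    (\<exists>\<phi>. bij_betw \<phi> (vcarrier X) (vcarrier Y) \<and>
      (\<forall>x\<in>vcarrier X. \<forall>y\<in>vcarrier X. \<phi> (vadd X x y) = vadd Y (\<phi> x) (\<phi> y)) \<and>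
      (\<forall>c. \<forall>x\<in>vcarrier X. \<phi> (vscale X c x) = vscale Y c (\<phi> x)))"

section \<open>Derivations and the first cohomology group\<close>

text \<open>
  Derivations from a subalgebra \<open>A\<close> into a space \<open>X\<close> of operators that is an \<open>A\<close>-bimodule under
  composition. A map on \<open>A\<close> is represented by the function extending it by \<open>0\<close> outside \<open>A\<close>, so
  that equality of maps on \<open>A\<close> is equality of functions; continuity refers to \<open>A\<close> only.
\<close>

definition continuous_derivations ::
    "'a ell2_op set \<Rightarrow> 'a ell2_op set \<Rightarrow> ('a ell2_op \<Rightarrow> 'a ell2_op) set" where
  "continuous_derivations A X = {D.
    (\<forall>S\<in>A. D S \<in> X) \<and> (\<forall>S. S \<notin> A \<longrightarrow> D S = 0) \<and>
    (\<forall>S\<in>A. \<forall>T\<in>A. D (S + T) = D S + D T) \<and>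
    (\<forall>c. \<forall>S\<in>A. D (op_scale c S) = op_scale c (D S)) \<and>
    (\<forall>S\<in>A. \<forall>T\<in>A. D (S o\<^sub>L T) = (S o\<^sub>L D T) + (D S o\<^sub>L T)) \<and>
    continuous_on A D}"

definition inner_derivations ::
    "'a ell2_op set \<Rightarrow> 'a ell2_op set \<Rightarrow> ('a ell2_op \<Rightarrow> 'a ell2_op) set" where
  "inner_derivations A X = {D \<in> continuous_derivations A X.
    \<exists>T\<in>X. \<forall>S\<in>A. D S = (S o\<^sub>L T) - (T o\<^sub>L S)}"

definition first_cohomology ::
    "'a ell2_op set \<Rightarrow> 'a ell2_op set \<Rightarrow> ('a ell2_op \<Rightarrow> 'a ell2_op) set cvector_space" where
  "first_cohomology A X = quotient_space (\<lambda>c D S. op_scale c (D S))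
    (continuous_derivations A X) (inner_derivations A X)"

end

theory Submission
  imports Defs
begin

text \<open>
  Let \<open>B\<close> be the Banach algebra generated by the left translations \<open>L\<^sub>s\<close>. The isomorphism is induced
  by the map that sends a multiplier \<open>T\<close> to the derivation \<open>A \<mapsto> A T - T A\<close> of \<open>B\<close>. It has to be shown
  that every continuous derivation of \<open>B\<close> arises in this way from some left convolution operator
  \<open>T\<close> (lemma \<open>derivation_implemented\<close>; such a \<open>T\<close> is automatically a multiplier), and that a
  multiplier that induces an inner derivation lies in \<open>B\<close> (lemma \<open>commutator_map_inner_iff\<close>). The
  rest is linear algebra (lemma \<open>quotient_space_isomorphicI\<close>).

  Both facts come from one feature of the semigroup: if \<open>j\<close> exceeds all indices in \<open>w\<close> and \<open>n\<close> is the
  length of \<open>w\<close>, then \<open>X\<^sub>j w = w X\<^sub>j\<^sub>+\<^sub>n\<close>, and for \<open>n > 0\<close> this element is not right divisible by \<open>X\<^sub>j\<close>.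

  For the second fact, let \<open>f * \<delta>\<^sub>X = \<delta>\<^sub>X * f\<close> for \<open>X = X\<^sub>j\<close>. Evaluation at \<open>X\<^sub>j w\<close> with \<open>j\<close> large gives
  \<open>0 = f(w)\<close> for every \<open>w\<close> other than the unit. Hence only scalars commute with all translations
  (lemma \<open>commuting_with_translations_scalar\<close>), and scalars lie in \<open>B\<close>.

  For the first fact, let \<open>D\<close> be a continuous derivation and let \<open>D(L\<^sub>s)\<close> be convolution by \<open>c\<^sub>s\<close>. Then
  \<open>c\<^sub>s\<^sub>t = \<delta>\<^sub>s * c\<^sub>t + c\<^sub>s * \<delta>\<^sub>t\<close>, and a function \<open>f\<close> with \<open>c\<^sub>s = \<delta>\<^sub>s * f - f * \<delta>\<^sub>s\<close> is needed. The same evaluation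
  shows that, off the unit, \<open>f(w)\<close> can only be \<open>c\<^sub>X(X w)\<close> with \<open>X = X\<^sub>j\<close> for large \<open>j\<close>; these values
  indeed stabilize. That this \<open>f\<close> works for a generator \<open>s = X\<^sub>i\<close> is the cocycle identity
  for the relation \<open>X\<^sub>j X\<^sub>i = X\<^sub>i X\<^sub>j\<^sub>+\<^sub>1\<close>, evaluated at \<open>X\<^sub>j w\<close> with \<open>j\<close> large. The argument fails exactly
  when \<open>w\<close> has length one; there the values \<open>c\<^sub>s(X\<^sub>k)\<close> for generators \<open>s\<close> have to vanish. Most of them
  vanish by the relations alone. The last ones, \<open>c\<^sub>s(s)\<close>, form a homomorphism into the additive group,
  and they vanish because \<open>D\<close> is bounded.

  Finally, convolution by \<open>f\<close> is bounded: on finitely many points and for \<open>g\<close> with finite support,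
  \<open>f * g\<close> at \<open>w\<close> is \<open>D(L\<^sub>X) g\<close> at \<open>X w\<close>, again with \<open>X = X\<^sub>j\<close> and \<open>j\<close> large. In other words, \<open>T\<close> is
  the weak limit of \<open>L\<^sub>X\<^sup>* D(L\<^sub>X)\<close>, and no average over the semigroup has to be taken.
\<close>

section \<open>Normal forms in Thompson's semigroup\<close>

abbreviation X :: "nat \<Rightarrow> thompson" where
  "X \<equiv> thompson_gen"

text \<open>
  Left multiplication by \<open>X\<^sub>j\<close> on normal forms: every element is a unique product
  \<open>X\<^sub>a X\<^sub>b \<dots>\<close> with nondecreasing indices, and \<open>j\<close> moves to the right past the smaller indices, by
  \<open>X\<^sub>j X\<^sub>i = X\<^sub>i X\<^sub>j\<^sub>+\<^sub>1\<close>.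
\<close>

fun insert_left :: "nat \<Rightarrow> nat list \<Rightarrow> nat list" where
  "insert_left j [] = [j]"
| "insert_left j (i # l) = (if j \<le> i then j # i # l else i # insert_left (j + 1) l)"

text \<open>
  Right multiplication by \<open>X\<^sub>j\<close>; here the normal form is stored from its last letter to its first,
  and \<open>j\<close> moves to the left past the larger indices, which increase by one.
\<close>

fun insert_right :: "nat \<Rightarrow> nat list \<Rightarrow> nat list" where
  "insert_right j [] = [j]"
| "insert_right j (i # l) = (if i \<le> j then j # i # l else (i + 1) # insert_right j l)"

lemma insert_left_relation:
  "i < j \<Longrightarrow> insert_left j (insert_left i l) = insert_left i (insert_left (j + 1) l)"
  by (induction l arbitrary: i j) auto

lemma insert_right_relation:
  "i < j \<Longrightarrow> insert_right i (insert_right j l) = insert_right (j + 1) (insert_right i l)"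
  by (induction l) auto

text \<open>
  Words act on the left on any set on which the generators act compatibly with the defining
  relation, and equivalent words act in the same way. This makes normal forms well defined.
  The mirror image for right actions follows.
\<close>

lemma thompson_step_foldr:
  assumes "\<And>i j x. i < j \<Longrightarrow> g j (g i x) = g i (g (j + 1) x)" "equivclp thompson_step u v"
  shows "foldr g u x = foldr g v x"
  using assms(2)
proof (induction rule: equivclp_induct)
  case (step y z)
  have "foldr g a x = foldr g b x" if "thompson_step a b" for a b
    using that assms(1) by cases auto
  with step show ?case by metis
qed simp

lemma thompson_step_fold:
  assumes "\<And>i j x. i < j \<Longrightarrow> g i (g j x) = g (j + 1) (g i x)" "equivclp thompson_step u v"
  shows "fold g u x = fold g v x"
  using assms(2)
proof (induction rule: equivclp_induct)
  case (step y z)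
  have "fold g a x = fold g b x" if "thompson_step a b" for a b
    using that assms(1) by cases auto
  with step show ?case by metis
qed simp

lift_definition left_nf :: "thompson \<Rightarrow> nat list" is "\<lambda>w. foldr insert_left w []"
  by (intro thompson_step_foldr insert_left_relation)

lift_definition right_nf :: "thompson \<Rightarrow> nat list" is "\<lambda>w. fold insert_right w []"
  by (intro thompson_step_fold insert_right_relation)

lemma left_nf_simps [simp]: "left_nf 1 = []" "left_nf (X i * w) = insert_left i (left_nf w)"
  by (transfer; simp)+

lemma right_nf_simps [simp]: "right_nf 1 = []" "right_nf (w * X i) = insert_right i (right_nf w)"
    "right_nf (X i) = [i]"
  by (transfer; simp)+

lemma abs_thompson_eq_prod: "abs_thompson l = prod_list (map X l)"
proof (induction l)
  case (Cons i l)
  then show ?case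
    using times_thompson.abs_eq[of "[i]" l] by (simp add: thompson_gen.abs_eq)
qed (simp add: one_thompson.abs_eq)

lemma ex_thompson_word: "\<exists>l. w = prod_list (map X l)"
  by (metis Quotient3_abs_rep Quotient3_thompson abs_thompson_eq_prod)

lemma thompson_induct_left [case_names one gen]:
  assumes "P 1" "\<And>i w. P w \<Longrightarrow> P (X i * w)"
  shows "P w"
proof -
  have "P (prod_list (map X l))" for l
    by (induction l) (auto intro: assms)
  then show ?thesis
    using ex_thompson_word by metis
qed

lemma thompson_induct_right [case_names one gen]:
  assumes "P 1" "\<And>i w. P w \<Longrightarrow> P (w * X i)"
  shows "P w"
proof -
  have "P (prod_list (map X l))" for l
    by (induction l rule: rev_induct) (auto intro: assms)
  then show ?thesis
    using ex_thompson_word by metis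
qed

lemma prod_insert_left: "prod_list (map X (insert_left j l)) = X j * prod_list (map X l)"
proof (induction l arbitrary: j)
  case (Cons i l)
  then show ?case
    using thompson_gen_relation[of i j] by (auto simp flip: mult.assoc)
qed simp

lemma prod_insert_right:
  "prod_list (map X (rev (insert_right j l))) = prod_list (map X (rev l)) * X j"
proof (induction l arbitrary: j)
  case (Cons i l)
  then show ?case
    using thompson_gen_relation[of j i] by (auto simp: mult.assoc)
qed simp

lemma prod_left_nf [simp]: "prod_list (map X (left_nf w)) = w"
  by (induction w rule: thompson_induct_left) (simp_all add: prod_insert_left)

lemma prod_right_nf [simp]: "prod_list (map X (rev (right_nf w))) = w"
  by (induction w rule: thompson_induct_right) (simp_all add: prod_insert_right del: rev_map)

lemma left_nf_inject: "left_nf v = left_nf w \<longleftrightarrow> v = w"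
  by (metis prod_left_nf)

lemma right_nf_inject: "right_nf v = right_nf w \<longleftrightarrow> v = w"
  by (metis prod_right_nf)

lemma set_insert_left: "x \<in> set (insert_left j l) \<Longrightarrow> j \<le> x \<or> x \<in> set l"
  by (induction l arbitrary: j) (force split: if_splits)+

lemma sorted_left_nf: "sorted (left_nf w)"
proof (induction w rule: thompson_induct_left)
  case (gen i w)
  have "sorted l \<Longrightarrow> sorted (insert_left i l)" for l
    by (induction l arbitrary: i) (fastforce dest: set_insert_left)+
  with gen show ?case by simp
qed simp

lemma set_insert_right: "x \<in> set (insert_right j l) \<Longrightarrow> x = j \<or> x \<in> set l \<or> x - 1 \<in> set l \<and> j + 1 < x"
  by (induction l) (auto split: if_splits)

lemma sorted_right_nf: "sorted_wrt (\<ge>) (right_nf w)"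
proof (induction w rule: thompson_induct_right)
  case (gen i w)
  have "sorted_wrt (\<ge>) l \<Longrightarrow> sorted_wrt (\<ge>) (insert_right i l)" for l
    by (induction l) (fastforce dest: set_insert_right)+
  with gen show ?case by simp
qed simp

section \<open>Cancellation and common multiples\<close>

lemma insert_left_neq_Nil [simp]: "insert_left j l \<noteq> []"
  by (cases l) auto

lemma insert_right_neq_Nil [simp]: "insert_right j l \<noteq> []"
  by (cases l) auto

lemma insert_left_inject: "insert_left j l = insert_left j m \<Longrightarrow> l = m"
proof (induction l arbitrary: j m)
  case Nil
  then show ?case by (cases m) (auto split: if_splits)
next
  case (Cons i l)
  then show ?case by (cases m) (auto split: if_splits)
qed

lemma insert_right_inject: "insert_right j l = insert_right j m \<Longrightarrow> l = m"
proof (induction l arbitrary: m)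
  case Nil
  then show ?case by (cases m) (auto split: if_splits)
next
  case (Cons i l)
  then show ?case by (cases m) (auto split: if_splits)
qed

lemma thompson_left_cancel [simp]: "u * v = u * w \<longleftrightarrow> v = (w :: thompson)"
proof -
  have "u * v = u * w \<Longrightarrow> v = w"
  proof (induction u rule: thompson_induct_left)
    case (gen i u)
    then have "insert_left i (left_nf (u * v)) = insert_left i (left_nf (u * w))"
      by (metis left_nf_simps(2) mult.assoc)
    then show ?case
      using gen.IH by (auto dest: insert_left_inject simp: left_nf_inject)
  qed simp
  then show ?thesis by auto
qed

lemma thompson_right_cancel [simp]: "v * u = w * u \<longleftrightarrow> v = (w :: thompson)"
proof -
  have "v * u = w * u \<Longrightarrow> v = w"
  proof (induction u rule: thompson_induct_right)
    case (gen i u)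
    then have "insert_right i (right_nf (v * u)) = insert_right i (right_nf (w * u))"
      by (metis right_nf_simps(2) mult.assoc)
    then show ?case
      using gen.IH by (auto dest: insert_right_inject simp: right_nf_inject)
  qed simp
  then show ?thesis by auto
qed

text \<open>
  The next two lemmas say that \<open>X\<^sub>j X\<^sub>i = X\<^sub>i X\<^sub>j\<^sub>+\<^sub>1\<close> is the least common right multiple of \<open>X\<^sub>i\<close> and \<open>X\<^sub>j\<close>.
  On normal forms this is a simultaneous induction: as long as the first letters are
  smaller than \<open>i\<close>, they agree and can be removed, which raises both indices by one.
\<close>

lemma insert_left_common:
  assumes "insert_left j l = insert_left i m" "i < j" "sorted l"
  shows "\<exists>r. l = insert_left i r \<and> m = insert_left (j + 1) r"
  using assms
proof (induction l arbitrary: i j m)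
  case Nil
  then show ?case by (cases m) (auto split: if_splits)
next
  case (Cons k l)
  show ?case
  proof (cases m)
    case Nil
    with Cons.prems show ?thesis by (auto split: if_splits)
  next
    case (Cons k' m')
    show ?thesis
    proof (cases "i \<le> k'")
      case True
      with Cons Cons.prems have "k = i" "m = insert_left (j + 1) l"
        by (auto split: if_splits)
      moreover have "i # l = insert_left i l"
        using Cons.prems \<open>k = i\<close> by (cases l) auto
      ultimately show ?thesis by auto
    next
      case False
      with Cons Cons.prems have k: "k = k'" "insert_left (j + 1) l = insert_left (i + 1) m'"
        by (auto split: if_splits)
      with Cons.IH[of "j + 1" "i + 1" m'] Cons.prems obtain r where
        "l = insert_left (i + 1) r" "m' = insert_left (j + 2) r" by auto
      with k Cons False Cons.prems(2) show ?thesis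
        by (intro exI[of _ "k # r"]) auto
    qed
  qed
qed

lemma common_right_multiple:
  assumes "X j * w = X i * u" "i < j"
  shows "\<exists>v. w = X i * v \<and> u = X (j + 1) * v"
proof -
  from assms have "insert_left j (left_nf w) = insert_left i (left_nf u)"
    by (metis left_nf_simps(2))
  from insert_left_common[OF this assms(2) sorted_left_nf] show ?thesis
    by (metis prod_left_nf prod_insert_left)
qed

text \<open>
  Common left multiples: \<open>X\<^sub>a\<close> and \<open>X\<^sub>b\<close> with \<open>a < b\<close> have the least common left multiple
  \<open>X\<^sub>b\<^sub>-\<^sub>1 X\<^sub>a = X\<^sub>a X\<^sub>b\<close> if \<open>a + 1 < b\<close>, and none if \<open>b = a + 1\<close>. The conclusion covers both cases: for
  \<open>b = a + 1\<close> it has the form \<open>l = m\<close>, which contradicts the premise.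
\<close>

lemma insert_right_common:
  assumes "insert_right a l = insert_right b m" "a < b" "sorted_wrt (\<ge>) l"
  shows "\<exists>r. l = insert_right (b - 1) r \<and> m = insert_right a r"
  using assms
proof (induction l arbitrary: m)
  case Nil
  then show ?case by (cases m) (auto split: if_splits)
next
  case (Cons k l)
  show ?case
  proof (cases m)
    case Nil
    with Cons.prems show ?thesis by (auto split: if_splits)
  next
    case (Cons k' m')
    show ?thesis
    proof (cases "k' \<le> b")
      case True
      with Cons Cons.prems have k: "k = b - 1" "m = insert_right a l"
        by (auto split: if_splits)
      moreover have "k # l = insert_right k l"
        using Cons.prems by (cases l) auto
      ultimately show ?thesis by auto
    next
      case False
      with Cons Cons.prems have k: "k = k'" "k > b" "insert_right a l = insert_right b m'"
        by (auto split: if_splits)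
      with Cons.IH[of m'] Cons.prems obtain r where
        "l = insert_right (b - 1) r" "m' = insert_right a r" by auto
      with k Cons False Cons.prems(2) show ?thesis
        by (intro exI[of _ "(k - 1) # r"]) auto
    qed
  qed
qed

lemma common_left_multiple:
  assumes "w * X a = u * X b" "a < b"
  shows "\<exists>v. w = v * X (b - 1) \<and> u = v * X a"
proof -
  from assms have "insert_right a (right_nf w) = insert_right b (right_nf u)"
    by (metis right_nf_simps(2))
  from insert_right_common[OF this assms(2) sorted_right_nf] show ?thesis
    by (metis prod_right_nf prod_insert_right)
qed

section \<open>Length and size of indices\<close>

definition thompson_length :: "thompson \<Rightarrow> nat" where
  "thompson_length w = length (right_nf w)"

lemma length_insert_right [simp]: "length (insert_right j l) = Suc (length l)"
  by (induction l) auto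

lemma thompson_length_simps [simp]: "thompson_length 1 = 0" "thompson_length (X i) = 1"
    "thompson_length (u * v) = thompson_length u + thompson_length v"
proof -
  show "thompson_length (u * v) = thompson_length u + thompson_length v"
    by (induction v rule: thompson_induct_right) 
      (simp_all add: thompson_length_def flip: mult.assoc)
qed (simp_all add: thompson_length_def)

lemma thompson_length_eq_0 [simp]: "thompson_length w = 0 \<longleftrightarrow> w = 1"
  using right_nf_inject[of w 1] by (simp add: thompson_length_def)

lemma thompson_length_eq_1: "thompson_length w = 1 \<Longrightarrow> \<exists>i. w = X i"
  using prod_right_nf[of w] unfolding thompson_length_def
  by (cases "right_nf w") (auto simp del: prod_right_nf)

text \<open>
  Multiplication on the right never removes or lowers an index of the normal form, so that a bound
  for a product is a bound for its left factors.
\<close>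

definition indices_below :: "nat \<Rightarrow> thompson \<Rightarrow> bool" where
  "indices_below N w \<longleftrightarrow> (\<forall>i\<in>set (right_nf w). i < N)"

lemma indices_below_mono: "indices_below M w \<Longrightarrow> M \<le> N \<Longrightarrow> indices_below N w"
  by (auto simp: indices_below_def)

lemma eventually_indices_below: "\<forall>\<^sub>F N in sequentially. indices_below N w"
proof -
  have "\<forall>\<^sub>F N in sequentially. i < N" for i :: nat
    by (rule eventually_gt_at_top)
  then show ?thesis
    unfolding indices_below_def by (intro eventually_ball_finite) auto
qed

lemma insert_right_bounds:
  "j \<in> set (insert_right j l)" "i \<in> set l \<Longrightarrow> \<exists>k\<in>set (insert_right j l). i \<le> k"
  by (induction l) (auto intro: le_SucI)

lemma indices_below_last: "indices_below N (w * X i) \<Longrightarrow> i < N"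
  using insert_right_bounds(1) by (auto simp: indices_below_def)

lemma indices_below_init: "indices_below N (u * v) \<Longrightarrow> indices_below N u"
proof (induction v rule: thompson_induct_right)
  case (gen i v)
  have "indices_below N (u * v)"
    unfolding indices_below_def
  proof
    fix k assume "k \<in> set (right_nf (u * v))"
    from insert_right_bounds(2)[OF this, of i] gen.prems show "k < N"
      by (auto simp: indices_below_def simp flip: mult.assoc)
  qed
  then show ?case by (rule gen.IH)
qed simp

text \<open>
  Each letter of \<open>w\<close> raises the index of the generator that passes it by one.
\<close>

lemma gen_past_word:
  "indices_below j w \<Longrightarrow> X j * w = w * X (j + thompson_length w)"
proof (induction w rule: thompson_induct_right)
  case (gen i w)
  have "i < j" and w: "indices_below j w"
    using gen.prems indices_below_last indices_below_init by blast+
  have "X j * (w * X i) = w * (X (j + thompson_length w) * X i)"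
    using gen.IH[OF w] by (simp flip: mult.assoc)
  also have "\<dots> = w * X i * X (j + thompson_length (w * X i))"
    using \<open>i < j\<close> thompson_gen_relation[of i "j + thompson_length w"] by (simp add: mult.assoc)
  finally show ?case .
qed simp

lemma gen_past_word_right_divisor:
  assumes "indices_below j w" "i < j" "X j * w = u * X i"
  shows "\<exists>v. u = X j * v \<and> w = v * X i"
proof (cases "w = 1")
  case True
  with assms have "u * X i = 1 * X j" by simp
  then obtain v where "1 = v * X i"
    using common_left_multiple assms(2) by blast
  then have "thompson_length 1 = thompson_length (v * X i)" by simp
  then show ?thesis by simp
next
  case False
  define n where "n = thompson_length w"
  from False have "n \<ge> 1"
    by (metis One_nat_def Suc_leI n_def neq0_conv thompson_length_eq_0)
  have "u * X i = w * X (j + n)"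
    using assms gen_past_word n_def by simp
  then obtain v where v: "u = v * X (j + n - 1)" "w = v * X i"
    using common_left_multiple[of u i w "j + n"] assms(2) by auto
  have "X j * v = v * X (j + thompson_length v)"
    using assms(1) v(2) indices_below_init gen_past_word by blast
  moreover have "n = Suc (thompson_length v)"
    by (simp add: n_def v(2))
  ultimately show ?thesis
    using v by auto
qed

text \<open>
  If \<open>j\<close> exceeds the indices of \<open>v\<close> and \<open>w\<close>, then the letter \<open>X\<^sub>j\<close> of \<open>X\<^sub>j w = u v\<close> belongs to \<open>u\<close>. The proof peels
  the letters off \<open>v\<close> from the right.
\<close>

lemma gen_factorization:
  assumes "indices_below j w" "indices_below j v" "X j * w = u * v"
  shows "\<exists>u'. u = X j * u' \<and> w = u' * v"
  using assms
proof (induction v arbitrary: w rule: thompson_induct_right)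
  case (gen i v)
  have i: "i < j" "indices_below j v"
    using gen.prems(2) indices_below_last indices_below_init by blast+
  have "X j * w = (u * v) * X i"
    using gen.prems(3) by (simp add: mult.assoc)
  from gen_past_word_right_divisor[OF gen.prems(1) i(1) this]
  obtain w' where w': "u * v = X j * w'" "w = w' * X i" by auto
  have "indices_below j w'"
    using gen.prems(1) w'(2) indices_below_init by blast
  from gen.IH[OF this i(2)] w' show ?case
    by (metis mult.assoc)
qed auto

text \<open>
  A common left multiple of \<open>X\<^sub>l\<close> and \<open>X\<^sub>m\<close> would force \<open>w\<close> to end in \<open>X\<^sub>l\<close>, but \<open>w\<close> has only smaller
  indices.
\<close>

lemma word_gen_not_right_divisible:
  assumes "indices_below l w" "l < m" "w * X m = u * X l"
  shows False
proof -
  from common_left_multiple[OF assms(3)[symmetric] assms(2)] obtain v where "w = v * X l" by blast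
  with assms(1) indices_below_last show False by blast
qed

text \<open>
  A left factor of \<open>w\<close> is at most as long as \<open>w\<close> and has no larger indices than \<open>w\<close>, and it determines
  the right factor by cancellation.
\<close>

lemma finite_thompson_factorizations: "finite {(u, v). u * v = (w :: thompson)}"
proof -
  obtain N where N: "indices_below N w"
    using eventually_happens[OF eventually_indices_below] by auto
  define U where "U = {u. \<exists>v. u * v = w}"
  have "right_nf ` U \<subseteq> {l. set l \<subseteq> {..<N} \<and> length l \<le> thompson_length w}"
  proof (intro image_subsetI CollectI conjI subsetI)
    fix u x assume "u \<in> U" and x: "x \<in> set (right_nf u)"
    then have "indices_below N u"
      using N indices_below_init by (auto simp: U_def)
    with x show "x \<in> {..<N}" by (simp add: indices_below_def)
  next
    fix u assume "u \<in> U"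
    then obtain v where "w = u * v" by (auto simp: U_def)
    then show "length (right_nf u) \<le> thompson_length w"
      by (simp flip: thompson_length_def)
  qed
  then have "finite (right_nf ` U)"
    by (rule finite_subset) (simp add: finite_lists_length_le)
  then have "finite U"
    by (rule finite_imageD) (simp add: inj_on_def right_nf_inject)
  moreover have "inj_on fst {(u, v). u * v = w}"
    by (auto simp: inj_on_def)
  moreover have "fst ` {(u, v). u * v = w} = U"
    by (force simp: U_def)
  ultimately show ?thesis
    by (metis finite_imageD)
qed

section \<open>Square-summable functions and operators\<close>

lemma Rep_ell2_simps [simp]:
  "Rep_ell2 0 x = 0" "Rep_ell2 (f + g) x = Rep_ell2 f x + Rep_ell2 g x"
  "Rep_ell2 (- f) x = - Rep_ell2 f x" "Rep_ell2 (f - g) x = Rep_ell2 f x - Rep_ell2 g x"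
  "Rep_ell2 (ell2_scale c f) x = c * Rep_ell2 f x"
  "Rep_ell2 (r *\<^sub>R f) x = complex_of_real r * Rep_ell2 f x"
  "Rep_ell2 (ell2_delta s) t = (if t = s then 1 else 0)"
  by (simp_all add: zero_ell2.rep_eq plus_ell2.rep_eq uminus_ell2.rep_eq diff_conv_add_uminus
      ell2_scale.rep_eq scaleR_ell2_def ell2_delta.rep_eq del: add_uminus_conv_diff)

lemma ell2_eqI: "(\<And>x. Rep_ell2 f x = Rep_ell2 g x) \<Longrightarrow> f = g"
  by (simp add: Rep_ell2_inject[symmetric] fun_eq_iff)

lemma norm_ell2_power2: "(norm f)\<^sup>2 = (\<Sum>\<^sub>\<infinity>x. (cmod (Rep_ell2 f x))\<^sup>2)"
  by (simp add: norm_ell2_eq infsum_nonneg)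

lemma sum_le_norm_ell2:
  "finite W \<Longrightarrow> (\<Sum>x\<in>W. (cmod (Rep_ell2 f x))\<^sup>2) \<le> (norm f)\<^sup>2"
  unfolding norm_ell2_power2 using Rep_ell2[of f] by (intro finite_sum_le_infsum) auto

lemma cmod_Rep_ell2_le: "cmod (Rep_ell2 f x) \<le> norm f"
  using sum_le_norm_ell2[of "{x}" f] by (auto intro: power2_le_imp_le)

lemma bounded_linear_Rep_ell2: "bounded_linear (\<lambda>f. Rep_ell2 f x)"
  by (rule bounded_linear_intro[where K = 1])
    (auto simp: cmod_Rep_ell2_le scaleR_conv_of_real)

lemma square_summableI:
  assumes "\<And>W. finite W \<Longrightarrow> (\<Sum>x\<in>W. (cmod (f x))\<^sup>2) \<le> K"
  shows "(\<lambda>x. (cmod (f x))\<^sup>2) summable_on UNIV"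
  by (rule nonneg_bdd_above_summable_on) (use assms in \<open>auto intro!: bdd_aboveI2\<close>)

lemma norm_ell2_leI:
  assumes "\<And>W. finite W \<Longrightarrow> (\<Sum>x\<in>W. (cmod (Rep_ell2 f x))\<^sup>2) \<le> K\<^sup>2" "K \<ge> 0"
  shows "norm f \<le> K"
proof (rule power2_le_imp_le)
  show "(norm f)\<^sup>2 \<le> K\<^sup>2"
    unfolding norm_ell2_power2 using Rep_ell2[of f] assms(1)
    by (intro infsum_le_finite_sums) auto
qed (fact assms(2))

lemma norm_ell2_delta: "norm (ell2_delta s) \<le> 1"
proof (rule norm_ell2_leI)
  fix W :: "'a set" assume "finite W"
  have "(\<Sum>x\<in>W. (cmod (Rep_ell2 (ell2_delta s) x))\<^sup>2) = (\<Sum>x\<in>W. if x = s then 1 else 0)"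
    by (intro sum.cong) auto
  also have "\<dots> \<le> 1\<^sup>2"
    using \<open>finite W\<close> by simp
  finally show "(\<Sum>x\<in>W. (cmod (Rep_ell2 (ell2_delta s) x))\<^sup>2) \<le> 1\<^sup>2" .
qed simp

lemma op_scale_of_real: "op_scale (complex_of_real r) T = r *\<^sub>R T"
  by (rule blinfun_eqI) (simp add: scaleR_ell2_def blinfun.scaleR_left)

lemma op_scale_minus1 [simp]: "op_scale (-1) T = - T"
  using op_scale_of_real[of "-1" T] by simp

lemma op_scale_add: "op_scale c (S + T) = op_scale c S + op_scale c T"
  by (intro blinfun_eqI ell2_eqI) (simp add: blinfun.add_left distrib_left)

lemma op_scale_diff: "op_scale c (S - T) = op_scale c S - op_scale c T"
  by (intro blinfun_eqI ell2_eqI) (simp add: blinfun.diff_left right_diff_distrib)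

lemma op_scale_compose_left: "op_scale c S o\<^sub>L T = op_scale c (S o\<^sub>L T)"
  by (rule blinfun_eqI) simp

lemma op_scale_compose_right:
  "S \<in> bounded_operators \<Longrightarrow> S o\<^sub>L op_scale c T = op_scale c (S o\<^sub>L T)"
  by (rule blinfun_eqI) (simp add: bounded_operators_def)

lemma closed_bounded_operators: "closed (bounded_operators :: 'a ell2_op set)"
proof -
  have eq: "bounded_operators
      = (\<Inter>c. \<Inter>f. {T :: 'a ell2_op. T (ell2_scale c f) = ell2_scale c (T f)})"
    by (auto simp: bounded_operators_def)
  show ?thesis
    unfolding eq
    by (intro closed_INT ballI closed_Collect_eq continuous_intros
        bounded_linear.continuous_on[OF bounded_linear_ell2_scale])
qed

lemma closed_subalgebraD:
  assumes "closed_subalgebra A"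
  shows "A \<subseteq> bounded_operators" "closed A" "0 \<in> A" "S \<in> A \<Longrightarrow> T \<in> A \<Longrightarrow> S + T \<in> A"
    "T \<in> A \<Longrightarrow> op_scale c T \<in> A" "S \<in> A \<Longrightarrow> T \<in> A \<Longrightarrow> S o\<^sub>L T \<in> A"
    "T \<in> A \<Longrightarrow> - T \<in> A" "S \<in> A \<Longrightarrow> T \<in> A \<Longrightarrow> S - T \<in> A"
proof -
  show 1: "A \<subseteq> bounded_operators" "closed A" "0 \<in> A" "S \<in> A \<Longrightarrow> T \<in> A \<Longrightarrow> S + T \<in> A"
    "T \<in> A \<Longrightarrow> op_scale c T \<in> A" "S \<in> A \<Longrightarrow> T \<in> A \<Longrightarrow> S o\<^sub>L T \<in> A" for S T c
    using assms by (simp_all add: closed_subalgebra_def)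
  show minus: "T \<in> A \<Longrightarrow> - T \<in> A" for T
    using 1(5)[of T "-1"] by simp
  show "S \<in> A \<Longrightarrow> T \<in> A \<Longrightarrow> S - T \<in> A"
    using 1(4)[of S "- T"] minus[of T] by simp
qed

section \<open>Convolution on cancellative monoids with finite factorizations\<close>

text \<open>
  Cancellation makes translations isometric. Finiteness makes convolution a finite sum, hence
  associative and pointwise continuous; so left convolution operators form a closed algebra.
\<close>

class finite_factorization_monoid = monoid_mult +
  assumes finite_factorizations [simp]: "finite {(u, v). u * v = w}"
    and mult_left_cancel_iff [simp]: "u * v = u * w \<longleftrightarrow> v = w"
    and mult_right_cancel_iff [simp]: "v * u = w * u \<longleftrightarrow> v = w"

instance thompson :: finite_factorization_monoid
  by standard (use finite_thompson_factorizations in auto)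

lemma convolution_eq_sum:
  "convolution f g (w :: 'a :: finite_factorization_monoid) = (\<Sum>(u, v)\<in>{(u, v). u * v = w}. f u * g v)"
  by (simp add: convolution_def)

lemma convolution_simps:
  fixes w :: "'a :: finite_factorization_monoid"
  shows "convolution (\<lambda>x. f x + f' x) g w = convolution f g w + convolution f' g w"
    "convolution f (\<lambda>x. g x + g' x) w = convolution f g w + convolution f g' w"
    "convolution (\<lambda>x. c * f x) g w = c * convolution f g w"
    "convolution f (\<lambda>x. c * g x) w = c * convolution f g w"
  by (simp_all add: convolution_eq_sum sum.distrib[symmetric] sum_distrib_left distrib_left
      distrib_right mult_ac case_prod_unfold)

lemma convolution_assoc:
  "convolution (convolution f g) h (w :: 'a :: finite_factorization_monoid) = convolution f (convolution g h) w"
proof -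
  let ?F = "\<lambda>w. {(u, v). u * v = (w :: 'a)}"
  have "convolution (convolution f g) h w
      = (\<Sum>p\<in>?F w. \<Sum>q\<in>?F (fst p). f (fst q) * g (snd q) * h (snd p))"
    by (simp add: convolution_eq_sum case_prod_unfold sum_distrib_right)
  also have "\<dots> = (\<Sum>(p, q)\<in>Sigma (?F w) (\<lambda>p. ?F (fst p)). f (fst q) * g (snd q) * h (snd p))"
    by (intro sum.Sigma ballI finite_factorizations)
  also have "\<dots> = (\<Sum>(p, q)\<in>Sigma (?F w) (\<lambda>p. ?F (snd p)). f (fst p) * (g (fst q) * h (snd q)))"
    by (rule sum.reindex_bij_witness[where
          i = "\<lambda>(p, q). ((fst p * fst q, snd q), (fst p, fst q))" and
          j = "\<lambda>(p, q). ((fst q, snd q * snd p), (snd q, snd p))"]) (auto simp: mult.assoc)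
  also have "\<dots> = (\<Sum>p\<in>?F w. \<Sum>q\<in>?F (snd p). f (fst p) * (g (fst q) * h (snd q)))"
    by (intro sum.Sigma[symmetric] ballI finite_factorizations)
  also have "\<dots> = convolution f (convolution g h) w"
    by (simp add: convolution_eq_sum case_prod_unfold sum_distrib_left)
  finally show ?thesis .
qed

abbreviation delta :: "'a \<Rightarrow> 'a \<Rightarrow> complex" where
  "delta s \<equiv> Rep_ell2 (ell2_delta s)"

lemma convolution_delta_left:
  "convolution (delta s) g (s * w) = g (w :: 'a :: finite_factorization_monoid)"
proof -
  have "convolution (delta s) g (s * w)
      = (\<Sum>(u, v)\<in>{(s, w)}. Rep_ell2 (ell2_delta s) u * g v)"
    unfolding convolution_eq_sum by (intro sum.mono_neutral_right) (auto split: if_splits)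
  then show ?thesis by simp
qed

lemma convolution_delta_left_0:
  assumes "\<And>v :: 'a :: finite_factorization_monoid. w \<noteq> s * v"
  shows "convolution (delta s) g w = 0"
  unfolding convolution_eq_sum by (rule sum.neutral) (use assms in auto)

lemma convolution_delta_right:
  "convolution f (delta s) (w * s) = f (w :: 'a :: finite_factorization_monoid)"
proof -
  have "convolution f (delta s) (w * s)
      = (\<Sum>(u, v)\<in>{(w, s)}. f u * Rep_ell2 (ell2_delta s) v)"
    unfolding convolution_eq_sum by (intro sum.mono_neutral_right) (auto split: if_splits)
  then show ?thesis by simp
qed

lemma convolution_delta_right_0:
  assumes "\<And>v :: 'a :: finite_factorization_monoid. w \<noteq> v * s"
  shows "convolution f (delta s) w = 0"
  unfolding convolution_eq_sum by (rule sum.neutral) (use assms in auto)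

section \<open>The algebra of left convolution operators\<close>

definition symbol :: "'a::monoid_mult ell2_op \<Rightarrow> 'a ell2" where
  "symbol T = T (ell2_delta 1)"

lemma symbol_eq:
  assumes "is_left_convolution f (T :: 'a :: finite_factorization_monoid ell2_op)"
  shows "symbol T = f"
proof (rule ell2_eqI)
  fix x
  show "Rep_ell2 (symbol T) x = Rep_ell2 f x"
    using assms convolution_delta_right[of "Rep_ell2 f" 1 x]
    by (simp add: is_left_convolution_def symbol_def)
qed

lemma left_convolution_algebra_iff:
  "(T :: 'a :: finite_factorization_monoid ell2_op) \<in> left_convolution_algebra \<longleftrightarrow> is_left_convolution (symbol T) T"
  unfolding left_convolution_algebra_def using symbol_eq by blast

lemma left_convolution_apply:
  "(T :: 'a :: finite_factorization_monoid ell2_op) \<in> left_convolution_algebra \<Longrightarrow>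
    Rep_ell2 (T g) w = convolution (Rep_ell2 (symbol T)) (Rep_ell2 g) w"
  by (simp add: left_convolution_algebra_iff is_left_convolution_def)

lemma left_convolution_eqI:
  assumes "(S :: 'a :: finite_factorization_monoid ell2_op) \<in> left_convolution_algebra" "T \<in> left_convolution_algebra"
    "\<And>x. Rep_ell2 (symbol S) x = Rep_ell2 (symbol T) x"
  shows "S = T"
  using assms ell2_eqI[OF assms(3)]
  by (intro blinfun_eqI ell2_eqI) (simp add: left_convolution_apply)

text \<open>
  Being a left convolution operator is a family of equations between continuous functions of the
  operator, because every value of a convolution is a finite sum.
\<close>

lemma closed_left_convolution_algebra:
  "closed (left_convolution_algebra :: 'a :: finite_factorization_monoid ell2_op set)"
proof -
  have eq: "left_convolution_algebra = bounded_operators \<inter> (\<Inter>g. \<Inter>w. {T :: 'a ell2_op. Rep_ell2 (T g) w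
      = (\<Sum>p\<in>{(u, v). u * v = w}. Rep_ell2 (T (ell2_delta 1)) (fst p) * Rep_ell2 g (snd p))})"
    by (rule set_eqI) (simp add: left_convolution_algebra_iff is_left_convolution_def symbol_def
        fun_eq_iff convolution_eq_sum case_prod_unfold)
  show ?thesis
    unfolding eq
    by (intro closed_Int closed_bounded_operators closed_INT ballI closed_Collect_eq
        continuous_intros bounded_linear.continuous_on[OF bounded_linear_Rep_ell2])
qed

lemma is_left_convolution_add:
  assumes S: "is_left_convolution f (S :: 'a :: finite_factorization_monoid ell2_op)"
    and T: "is_left_convolution g T"
  shows "is_left_convolution (f + g) (S + T)"
proof -
  have "S + T \<in> bounded_operators"
    using assms by (auto simp: is_left_convolution_def bounded_operators_def blinfun.add_left
        distrib_left intro!: ell2_eqI)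
  moreover have "Rep_ell2 ((S + T) h) x = convolution (Rep_ell2 (f + g)) (Rep_ell2 h) x" for h x
    using S T by (simp add: is_left_convolution_def blinfun.add_left convolution_simps plus_ell2.rep_eq)
  ultimately show ?thesis
    unfolding is_left_convolution_def by (simp only: fun_eq_iff simp_thms)
qed

lemma is_left_convolution_scale:
  assumes S: "is_left_convolution f (S :: 'a :: finite_factorization_monoid ell2_op)"
  shows "is_left_convolution (ell2_scale c f) (op_scale c S)"
proof -
  have "op_scale c S \<in> bounded_operators"
    using assms by (auto simp: is_left_convolution_def bounded_operators_def
        mult.left_commute intro!: ell2_eqI)
  moreover have "Rep_ell2 (op_scale c S h) x = convolution (Rep_ell2 (ell2_scale c f)) (Rep_ell2 h) x" for h x
    using S by (simp add: is_left_convolution_def convolution_simps ell2_scale.rep_eq)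
  ultimately show ?thesis
    unfolding is_left_convolution_def by (simp only: fun_eq_iff simp_thms)
qed

lemma is_left_convolution_compose:
  assumes "is_left_convolution f (S :: 'a :: finite_factorization_monoid ell2_op)"
    and "is_left_convolution g T"
  shows "is_left_convolution (S g) (S o\<^sub>L T)"
proof -
  have "convolution (convolution (Rep_ell2 f) (Rep_ell2 g)) h = convolution (Rep_ell2 f) (convolution (Rep_ell2 g) h)"
    for h
    by (rule ext) (rule convolution_assoc)
  with assms show ?thesis
    unfolding is_left_convolution_def by (simp add: bounded_operators_def)
qed

lemma closed_subalgebra_left_convolution_algebra:
  "closed_subalgebra (left_convolution_algebra :: 'a :: finite_factorization_monoid ell2_op set)"
proof -
  have "is_left_convolution 0 (0 :: 'a ell2_op)"
    by (simp add: is_left_convolution_def bounded_operators_def convolution_eq_sum ell2_eqI fun_eq_iff)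
  moreover have "left_convolution_algebra \<subseteq> (bounded_operators :: 'a ell2_op set)"
    by (auto simp: left_convolution_algebra_def is_left_convolution_def)
  ultimately show ?thesis
    unfolding closed_subalgebra_def
  proof (intro conjI ballI allI)
    fix S T :: "'a ell2_op" and c
    assume "S \<in> left_convolution_algebra" "T \<in> left_convolution_algebra"
    then obtain f g where "is_left_convolution f S" "is_left_convolution g T"
      by (auto simp: left_convolution_algebra_def)
    then show "S + T \<in> left_convolution_algebra" "S o\<^sub>L T \<in> left_convolution_algebra"
      unfolding left_convolution_algebra_def
      by (auto intro: is_left_convolution_add is_left_convolution_compose)
  next
    fix T :: "'a ell2_op" and c
    assume "T \<in> left_convolution_algebra"
    then show "op_scale c T \<in> left_convolution_algebra"
      unfolding left_convolution_algebra_def by (auto intro: is_left_convolution_scale)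
  qed (auto simp: left_convolution_algebra_def closed_left_convolution_algebra[unfolded left_convolution_algebra_def])
qed

text \<open>
  It suffices to bound \<open>f * g\<close> on finite sets of points. Square-summability of \<open>f\<close> itself follows,
  since \<open>f = f * \<delta>\<close> with \<open>\<delta>\<close> the basis vector of the unit.
\<close>

lemma ex_left_convolution:
  fixes f :: "'a :: finite_factorization_monoid \<Rightarrow> complex"
  assumes bound: "\<And>g W. finite W \<Longrightarrow>
      (\<Sum>w\<in>W. (cmod (convolution f (Rep_ell2 g) w))\<^sup>2) \<le> (K * norm g)\<^sup>2"
    and "K \<ge> 0"
  obtains F T where "Rep_ell2 F = f" "is_left_convolution F T" "norm T \<le> K"
proof -
  define A where "A = (\<lambda>g. Abs_ell2 (convolution f (Rep_ell2 g)))"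
  have A: "Rep_ell2 (A g) = convolution f (Rep_ell2 g)" for g
    unfolding A_def using bound by (intro Abs_ell2_inverse) (auto intro: square_summableI)
  have norm: "norm (A g) \<le> K * norm g" for g
    using bound \<open>K \<ge> 0\<close> by (intro norm_ell2_leI) (auto simp: A)
  have add: "A (g + h) = A g + A h" and scale: "A (ell2_scale c g) = ell2_scale c (A g)" for g h c
    by (auto intro!: ell2_eqI simp: A convolution_simps plus_ell2.rep_eq ell2_scale.rep_eq)
  have "bounded_linear A"
    using norm by (intro bounded_linear_intro[where K = K])
      (auto simp: add scale scaleR_ell2_def mult.commute)
  then have T [simp]: "blinfun_apply (Blinfun A) = A"
    by (rule bounded_linear_Blinfun_apply)
  have f: "Rep_ell2 (A (ell2_delta 1)) = f"
    using convolution_delta_right[of f 1, simplified] by (auto simp: A)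
  show thesis
  proof (rule that)
    show "is_left_convolution (A (ell2_delta 1)) (Blinfun A)"
      unfolding is_left_convolution_def f by (auto simp: A scale bounded_operators_def)
    show "norm (Blinfun A) \<le> K"
      using norm \<open>K \<ge> 0\<close> by (intro norm_blinfun_bound) auto
  qed (rule f)
qed

section \<open>Left translations and the algebra they generate\<close>

lemma ex_translation:
  "\<exists>T. is_left_convolution (ell2_delta (s :: 'a :: finite_factorization_monoid)) T \<and> norm T \<le> 1"
proof (rule ex_left_convolution[where f = "delta s" and K = 1])
  fix g :: "'a ell2" and W :: "'a set"
  assume W: "finite W"
  define V where "V = {v. s * v \<in> W}"
  have inj: "inj_on ((*) s) V" for V
    by (simp add: inj_on_def)
  have "finite V"
    unfolding V_def using finite_vimageI[OF W, of "(*) s"] inj by (simp add: vimage_def)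
  have "(\<Sum>w\<in>W. (cmod (convolution (delta s) (Rep_ell2 g) w))\<^sup>2)
      = (\<Sum>w\<in>(*) s ` V. (cmod (convolution (delta s) (Rep_ell2 g) w))\<^sup>2)"
    using W by (intro sum.mono_neutral_right) (auto simp: V_def intro!: convolution_delta_left_0)
  also have "\<dots> = (\<Sum>v\<in>V. (cmod (Rep_ell2 g v))\<^sup>2)"
    by (simp add: sum.reindex inj convolution_delta_left)
  also have "\<dots> \<le> (1 * norm g)\<^sup>2"
    using sum_le_norm_ell2[OF \<open>finite V\<close>] by simp
  finally show "(\<Sum>w\<in>W. (cmod (convolution (delta s) (Rep_ell2 g) w))\<^sup>2)
      \<le> (1 * norm g)\<^sup>2" .
next
  fix F T
  assume "Rep_ell2 F = delta s" "is_left_convolution F T" "norm T \<le> 1"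
  then show ?thesis
    by (auto simp: Rep_ell2_inject)
qed simp

definition translation :: "'a :: finite_factorization_monoid \<Rightarrow> 'a ell2_op" where
  "translation s = (SOME T. is_left_convolution (ell2_delta s) T \<and> norm T \<le> 1)"

lemma translation: "is_left_convolution (ell2_delta s) (translation s)" "norm (translation s) \<le> 1"
  using someI_ex[OF ex_translation[of s]] by (auto simp: translation_def)

lemma symbol_translation [simp]: "symbol (translation s) = ell2_delta s"
  using symbol_eq translation by blast

lemma translation_in_left_convolution_algebra: "translation s \<in> left_convolution_algebra"
  using translation(1) by (auto simp: left_convolution_algebra_def)

lemma is_left_convolution_delta_iff: "is_left_convolution (ell2_delta s) T \<longleftrightarrow> T = translation s"
  using translation(1) by (metis blinfun_eqI is_left_convolution_def Rep_ell2_inject)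

lemma translation_apply:
  "Rep_ell2 (translation s g) = convolution (delta s) (Rep_ell2 g)"
  using translation(1) by (auto simp: is_left_convolution_def)

lemma translation_delta: "translation s (ell2_delta t) = ell2_delta (s * t)"
proof (rule ell2_eqI)
  fix x
  show "Rep_ell2 (translation s (ell2_delta t)) x = Rep_ell2 (ell2_delta (s * t)) x"
  proof (cases "\<exists>v. x = s * v")
    case True
    then show ?thesis
      by (auto simp: translation_apply convolution_delta_left)
  next
    case False
    then show ?thesis
      by (auto simp: translation_apply convolution_delta_left_0)
  qed
qed

lemma translation_mult: "translation (s * t) = translation s o\<^sub>L translation t"
proof (rule left_convolution_eqI)
  show "translation s o\<^sub>L translation t \<in> left_convolution_algebra"
    by (intro closed_subalgebraD(6) closed_subalgebra_left_convolution_algebra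
        translation_in_left_convolution_algebra)
  show "Rep_ell2 (symbol (translation (s * t))) x = Rep_ell2 (symbol (translation s o\<^sub>L translation t)) x" for x
    by (simp add: symbol_def translation_delta)
qed (rule translation_in_left_convolution_algebra)

lemma translation_one: "translation 1 = id_blinfun"
proof (intro blinfun_eqI ell2_eqI)
  fix g and x :: 'a
  show "Rep_ell2 (translation 1 g) x = Rep_ell2 (id_blinfun g) x"
    using convolution_delta_left[of 1 "Rep_ell2 g" x] by (simp add: translation_apply)
qed

lemma semigroup_banach_algebra_minimal:
  assumes "closed_subalgebra A" "\<And>s. translation s \<in> A"
  shows "semigroup_banach_algebra \<subseteq> A"
  unfolding semigroup_banach_algebra_def
  by (rule hull_minimal) (use assms in \<open>auto simp: is_left_convolution_delta_iff\<close>)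

lemma translation_in_semigroup_banach_algebra: "translation s \<in> semigroup_banach_algebra"
  unfolding semigroup_banach_algebra_def
  by (rule hull_inc) (auto simp: is_left_convolution_delta_iff)

lemma semigroup_banach_algebra_subset:
  "(semigroup_banach_algebra :: 'a :: finite_factorization_monoid ell2_op set)
    \<subseteq> left_convolution_algebra"
  by (intro semigroup_banach_algebra_minimal closed_subalgebra_left_convolution_algebra
      translation_in_left_convolution_algebra)

text \<open>
  A hull with respect to \<^const>\<open>closed_subalgebra\<close> is an intersection of closed subalgebras. The
  intersection is a closed subalgebra only if it has at least one member, as an empty one would
  contain operators that are not complex-linear. Left convolution operators provide the member.
\<close>

lemma closed_subalgebra_semigroup_banach_algebra:
  "closed_subalgebra (semigroup_banach_algebra :: 'a :: finite_factorization_monoid ell2_op set)"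
proof -
  define \<A> where "\<A> = {A. closed_subalgebra A \<and> {T. \<exists>s :: 'a. is_left_convolution (ell2_delta s) T} \<subseteq> A}"
  have B: "semigroup_banach_algebra = \<Inter>\<A>"
    by (simp add: semigroup_banach_algebra_def hull_def \<A>_def)
  have L: "left_convolution_algebra \<in> \<A>"
    using closed_subalgebra_left_convolution_algebra
    by (auto simp: \<A>_def left_convolution_algebra_def)
  have \<A>: "closed_subalgebra A" if "A \<in> \<A>" for A
    using that by (simp add: \<A>_def)
  have "closed (\<Inter>\<A>)"
    using \<A> by (intro closed_Inter ballI closed_subalgebraD(2))
  moreover have "\<Inter>\<A> \<subseteq> bounded_operators"
    using closed_subalgebraD(1)[OF \<A>[OF L]] L by blast
  ultimately show ?thesis
    unfolding closed_subalgebra_def B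
    by (intro conjI ballI allI InterI) (simp_all add: \<A> closed_subalgebraD)
qed

section \<open>Operators commuting with the translations\<close>

lemma Rep_symbol_compose_translation:
  "T \<in> left_convolution_algebra \<Longrightarrow> Rep_ell2 (symbol (T o\<^sub>L translation s)) w
    = convolution (Rep_ell2 (symbol T)) (delta s) w"
  by (simp add: symbol_def translation_delta left_convolution_apply[unfolded symbol_def])

lemma Rep_symbol_translation_compose:
  "Rep_ell2 (symbol (translation s o\<^sub>L T)) w
    = convolution (delta s) (Rep_ell2 (symbol T)) w"
  by (simp add: symbol_def translation_apply)

text \<open>
  For \<open>w \<noteq> 1\<close> and \<open>j\<close> large, \<open>X\<^sub>j w\<close> is divisible by \<open>X\<^sub>j\<close> on the left and not on the right, so one side of
  the commutation relation takes the value \<open>f(w)\<close> there, where \<open>f\<close> is the symbol, and the other is zero.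
\<close>

lemma commuting_with_translations_scalar:
  fixes T :: "thompson ell2_op"
  assumes T: "T \<in> left_convolution_algebra"
    and comm: "\<And>j. T o\<^sub>L translation (X j) = translation (X j) o\<^sub>L T"
  shows "T = op_scale (Rep_ell2 (symbol T) 1) (translation 1)"
proof (rule left_convolution_eqI)
  show "op_scale (Rep_ell2 (symbol T) 1) (translation 1) \<in> left_convolution_algebra"
    by (intro closed_subalgebraD(5) closed_subalgebra_left_convolution_algebra
        translation_in_left_convolution_algebra)
  fix w :: thompson
  have "Rep_ell2 (symbol T) w = 0" if "w \<noteq> 1"
  proof -
    obtain j where j: "indices_below j w"
      using eventually_happens[OF eventually_indices_below] by auto
    have "Rep_ell2 (symbol T) w = Rep_ell2 (symbol (translation (X j) o\<^sub>L T)) (X j * w)"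
      by (simp only: Rep_symbol_translation_compose convolution_delta_left)
    also have "\<dots> = Rep_ell2 (symbol (T o\<^sub>L translation (X j))) (X j * w)"
      by (simp only: comm)
    also have "\<dots> = convolution (Rep_ell2 (symbol T)) (delta (X j)) (X j * w)"
      by (simp only: Rep_symbol_compose_translation[OF T])
    also have "\<dots> = 0"
    proof (rule convolution_delta_right_0)
      fix v
      show "X j * w \<noteq> v * X j"
        using word_gen_not_right_divisible[OF j, of "j + thompson_length w" v] that
        by (auto simp: gen_past_word[OF j] neq0_conv[symmetric])
    qed
    finally show ?thesis .
  qed
  then show "Rep_ell2 (symbol T) w
      = Rep_ell2 (symbol (op_scale (Rep_ell2 (symbol T) 1) (translation 1))) w"
    by (cases "w = 1") (simp_all add: symbol_def translation_delta)
qed (rule T)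

lemma blinfun_compose_id: "id_blinfun o\<^sub>L S = S" "S o\<^sub>L id_blinfun = S"
  by (rule blinfun_eqI; simp)+

section \<open>Bounded cocycles on Thompson's semigroup\<close>

definition restrict_ell2 :: "'a set \<Rightarrow> 'a ell2 \<Rightarrow> 'a ell2" where
  "restrict_ell2 V g = Abs_ell2 (\<lambda>x. if x \<in> V then Rep_ell2 g x else 0)"

lemma sum_restrict_le:
  assumes "finite W"
  shows "(\<Sum>x\<in>W. (cmod (if x \<in> V then Rep_ell2 g x else 0))\<^sup>2) \<le> (norm g)\<^sup>2"
  by (rule order_trans[OF sum_mono sum_le_norm_ell2[OF assms]]) auto

lemma Rep_restrict_ell2: "Rep_ell2 (restrict_ell2 V g) x = (if x \<in> V then Rep_ell2 g x else 0)"
proof -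
  have "(\<lambda>x. (cmod (if x \<in> V then Rep_ell2 g x else 0))\<^sup>2) summable_on UNIV"
    by (rule square_summableI[OF sum_restrict_le])
  then have "Rep_ell2 (restrict_ell2 V g) = (\<lambda>x. if x \<in> V then Rep_ell2 g x else 0)"
    unfolding restrict_ell2_def by (intro Abs_ell2_inverse) simp
  then show ?thesis by simp
qed

lemma norm_restrict_ell2: "norm (restrict_ell2 V g) \<le> norm g"
  by (rule norm_ell2_leI) (simp_all only: Rep_restrict_ell2 sum_restrict_le norm_ge_zero)

lemma two_letter_right_divisor:
  assumes "X a * X b = u * X d"
  shows "\<exists>m. u = X m \<and> insert_right b [a] = insert_right d [m]"
proof -
  have "thompson_length (X a * X b) = thompson_length (u * X d)"
    by (simp only: assms)
  then obtain m where m: "u = X m"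
    using thompson_length_eq_1[of u] by auto
  then have "right_nf (X a * X b) = right_nf (X m * X d)"
    by (simp only: assms)
  with m show ?thesis
    by (intro exI[of _ m]) (simp del: insert_right.simps)
qed

lemma two_letter_left_divisor:
  assumes "X a * X b = X d * u"
  shows "\<exists>m. u = X m \<and> insert_right b [a] = insert_right m [d]"
proof -
  have "thompson_length (X a * X b) = thompson_length (X d * u)"
    by (simp only: assms)
  then obtain m where m: "u = X m"
    using thompson_length_eq_1[of u] by auto
  then have "right_nf (X a * X b) = right_nf (X d * X m)"
    by (simp only: assms)
  with m show ?thesis
    by (intro exI[of _ m]) (simp del: insert_right.simps)
qed

text \<open>
  The functions \<open>c\<^sub>s\<close> for which \<open>D(L\<^sub>s)\<close> is convolution by \<open>c\<^sub>s\<close>, for a derivation \<open>D\<close> with bound \<open>K\<close>.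
  The bound on convolutions is stated on finite sets of points, the form in which it passes to limits.
\<close>

locale bounded_cocycle =
  fixes c :: "thompson \<Rightarrow> thompson \<Rightarrow> complex" and K :: real
  assumes cocycle: "c (s * t) w = convolution (delta s) (c t) w + convolution (c s) (delta t) w"
    and bounded: "finite W \<Longrightarrow> (\<Sum>w\<in>W. (cmod (convolution (c s) (Rep_ell2 g) w))\<^sup>2) \<le> (K * norm g)\<^sup>2"
    and nonneg: "K \<ge> 0"
begin

lemma cmod_cocycle_le: "cmod (c s w) \<le> K"
proof -
  have "(cmod (c s w))\<^sup>2 \<le> (K * norm (ell2_delta (1 :: thompson)))\<^sup>2"
    using bounded[of "{w}" s "ell2_delta 1"] convolution_delta_right[of "c s" 1 w]
    by simp
  also have "\<dots> \<le> K\<^sup>2"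
    using nonneg by (intro power_mono mult_left_le norm_ell2_delta mult_nonneg_nonneg norm_ge_zero)
  finally show ?thesis
    using nonneg by (rule power2_le_imp_le)
qed

lemma cocycle_relation:
  assumes "i < j"
  shows "convolution (delta (X j)) (c (X i)) w + convolution (c (X j)) (delta (X i)) w
    = convolution (delta (X i)) (c (X (j + 1))) w + convolution (c (X i)) (delta (X (j + 1))) w"
  using cocycle[of "X j" "X i" w] cocycle[of "X i" "X (j + 1)" w] thompson_gen_relation[OF assms]
  by simp

text \<open>
  The cocycle identity for the relation of \<open>X\<^sub>k\<close> and \<open>X\<^sub>i\<close>, evaluated at the square of \<open>X\<^sub>k\<close>. This
  element has no other factorization into two generators, so a single term survives.
\<close>

lemma cocycle_gen_greater:
  assumes "i < k"
  shows "c (X i) (X k) = 0"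
proof -
  have "convolution (c (X k)) (delta (X i)) (X k * X k) = 0"
    "convolution (c (X i)) (delta (X (k + 1))) (X k * X k) = 0"
    by (rule convolution_delta_right_0;
        use assms in \<open>auto dest!: two_letter_right_divisor split: if_splits\<close>)+
  moreover have "convolution (delta (X i)) (c (X (k + 1))) (X k * X k) = 0"
    by (rule convolution_delta_left_0;
        use assms in \<open>auto dest!: two_letter_left_divisor split: if_splits\<close>)
  ultimately show ?thesis
    using cocycle_relation[OF assms, of "X k * X k"] by (simp only: convolution_delta_left) simp
qed

text \<open>
  For \<open>k + 1 < i\<close>, the relation of \<open>X\<^sub>i\<close> and \<open>X\<^sub>k\<^sub>+\<^sub>1\<close> at \<open>X\<^sub>k X\<^sub>k\<^sub>+\<^sub>1\<close> leaves a single term. For \<open>i = k + 1\<close>, the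
  relation of \<open>X\<^sub>k\<^sub>+\<^sub>1\<close> and \<open>X\<^sub>k\<close> at the square of \<open>X\<^sub>k\<close> reduces to the case \<open>i = k + 2\<close>.
\<close>

lemma cocycle_gen_less:
  assumes "k < i"
  shows "c (X i) (X k) = 0"
proof -
  have 1: "c (X i) (X k) = 0" if "k + 1 < i" for i
  proof -
    have "convolution (delta (X i)) (c (X (k + 1))) (X k * X (k + 1)) = 0"
      "convolution (delta (X (k + 1))) (c (X (i + 1))) (X k * X (k + 1)) = 0"
      by (rule convolution_delta_left_0;
          use that in \<open>auto dest!: two_letter_left_divisor split: if_splits\<close>)+
    moreover have "convolution (c (X (k + 1))) (delta (X (i + 1))) (X k * X (k + 1)) = 0"
      by (rule convolution_delta_right_0;
          use that in \<open>auto dest!: two_letter_right_divisor split: if_splits\<close>)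
    ultimately show ?thesis
      using cocycle_relation[OF that, of "X k * X (k + 1)"]
      by (simp only: convolution_delta_right) simp
  qed
  have "convolution (delta (X (k + 1))) (c (X k)) (X k * X k) = 0"
    by (rule convolution_delta_left_0;
        auto dest!: two_letter_left_divisor split: if_splits)
  moreover have "convolution (c (X k)) (delta (X (k + 2))) (X k * X k) = 0"
    by (rule convolution_delta_right_0;
        auto dest!: two_letter_right_divisor split: if_splits)
  ultimately have "c (X (k + 1)) (X k) = c (X (k + 2)) (X k)"
    using cocycle_relation[of k "k + 1" "X k * X k"]
    by (simp add: convolution_delta_left convolution_delta_right)
  also have "\<dots> = 0"
    by (rule 1) simp
  finally show ?thesis
    using 1[of i] assms by (cases "i = k + 1") auto
qed

text \<open>
  The value of \<open>c\<^sub>s\<close> at \<open>s\<close> is additive in \<open>s\<close>, so on the powers of a generator it grows linearly unless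
  it vanishes. Boundedness of the derivation is essential here: the unbounded derivation
  \<open>L\<^sub>s \<mapsto> n L\<^sub>s\<close>, with \<open>n\<close> the length of \<open>s\<close>, satisfies the algebraic identities.
\<close>

lemma cocycle_gen_same: "c (X i) (X i) = 0"
proof (rule ccontr)
  assume nz: "c (X i) (X i) \<noteq> 0"
  have "c (X i ^ n) (X i ^ n) = of_nat n * c (X i) (X i)" for n
  proof (induction n)
    case 0
    have "c 1 1 = c 1 1 + c 1 1"
      using cocycle[of 1 1 1] convolution_delta_left[of 1 "c 1" 1]
        convolution_delta_right[of "c 1" 1 1] by simp
    then show ?case by simp
  next
    case (Suc n)
    then show ?case
      by (simp add: cocycle convolution_delta_left convolution_delta_right algebra_simps)
  qed
  then have "real n * cmod (c (X i) (X i)) \<le> K" for n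
    using cmod_cocycle_le[of "X i ^ n" "X i ^ n"] by (simp add: norm_mult)
  moreover obtain n where "K < real n * cmod (c (X i) (X i))"
    using reals_Archimedean3[of "cmod (c (X i) (X i))"] nz by auto
  ultimately show False
    using leD by blast
qed

lemma cocycle_gen_gen: "c (X i) (X k) = 0"
  using cocycle_gen_greater cocycle_gen_less cocycle_gen_same by (cases i k rule: linorder_cases) auto

text \<open>
  In the cocycle identity for \<open>X\<^sub>j X\<^sub>i = X\<^sub>i X\<^sub>j\<^sub>+\<^sub>1\<close> at \<open>X\<^sub>j X\<^sub>i w\<close> the two right translates vanish, and the
  left translates give the two sides of the claim, with \<open>k = j + 1\<close>. The lower bound on \<open>k\<close>
  keeps \<open>j + 1\<close> away from \<open>i + n\<close>, the index with which \<open>X\<^sub>i\<close> leaves \<open>w\<close> on the right.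
\<close>

lemma cocycle_shifted_eq:
  assumes N: "indices_below i w" and w: "w \<noteq> 1" and k: "i + thompson_length w + 1 < k"
  shows "c (X i) (X i * w) = c (X k) (X k * w)"
proof -
  define n where "n = thompson_length w"
  define j where "j = k - 1"
  have n: "n > 0"
    using w by (auto simp: n_def neq0_conv[symmetric])
  have j: "i < j" "k = j + 1" "i + n < j + 1"
    using k by (auto simp: j_def n_def)
  have past: "X l * w = w * X (l + n)" if "i \<le> l" for l
    unfolding n_def using N that by (intro gen_past_word) (rule indices_below_mono)
  have rel: "X j * (X i * w) = X i * (X (j + 1) * w)"
    using thompson_gen_relation[OF j(1)] by (simp flip: mult.assoc)
  have "convolution (c (X j)) (delta (X i)) (X j * (X i * w)) = 0"
  proof (rule convolution_delta_right_0, rule notI)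
    fix v assume "X j * (X i * w) = v * X i"
    also have "X j * (X i * w) = w * X (j + n) * X (i + n)"
      using j past[of i] past[of j] by (metis le_refl less_imp_le mult.assoc)
    finally obtain v' where "w * X (j + n) = v' * X i"
      using common_left_multiple[of v i "w * X (j + n)" "i + n"] n by auto
    then show False
      using word_gen_not_right_divisible[OF N, of "j + n" v'] j by simp
  qed
  moreover have "convolution (c (X i)) (delta (X (j + 1))) (X i * (X (j + 1) * w)) = 0"
  proof (rule convolution_delta_right_0, rule notI)
    fix v assume "X i * (X (j + 1) * w) = v * X (j + 1)"
    also have "X i * (X (j + 1) * w) = w * X (i + n) * X (j + 1 + n)"
      using j past[of i] past[of "j + 1"] by (metis le_refl less_imp_le mult.assoc trans_le_add1)
    finally obtain v' where "w * X (i + n) = v' * X (j + 1)"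
      using common_left_multiple[of v "j + 1" "w * X (i + n)" "j + 1 + n"] n by auto
    then obtain u where "w = u * X j"
      using common_left_multiple[of w "i + n" v' "j + 1"] j by auto
    then show False
      using N indices_below_last j by fastforce
  qed
  ultimately show ?thesis
    using cocycle_relation[OF j(1), of "X j * (X i * w)"] unfolding j(2)
    by (simp add: rel convolution_delta_left flip: rel)
      (simp add: rel convolution_delta_left)
qed

definition potential :: "thompson \<Rightarrow> complex" where
  "potential w = (SOME a. \<forall>\<^sub>F j in sequentially. c (X j) (X j * w) = a)"

lemma eventually_potential: "\<forall>\<^sub>F j in sequentially. c (X j) (X j * w) = potential w"
proof -
  have "\<exists>a. \<forall>\<^sub>F j in sequentially. c (X j) (X j * w) = a"
  proof (cases "w = 1")
    case True
    then show ?thesis by (auto simp: cocycle_gen_gen)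
  next
    case False
    obtain N where N: "indices_below N w"
      using eventually_happens[OF eventually_indices_below] by auto
    have "c (X j) (X j * w) = c (X N) (X N * w)" if "j \<ge> N" for j
      using cocycle_shifted_eq[OF N False, of "j + thompson_length w + 2"]
        cocycle_shifted_eq[OF indices_below_mono[OF N that] False, of "j + thompson_length w + 2"] that
      by simp
    then show ?thesis
      by (auto simp: eventually_sequentially)
  qed
  then show ?thesis
    unfolding potential_def by (rule someI_ex)
qed

text \<open>
  The cocycle identity for \<open>X\<^sub>j X\<^sub>i = X\<^sub>i X\<^sub>j\<^sub>+\<^sub>1\<close> at \<open>X\<^sub>j w\<close>, with \<open>j\<close> large. Its first term is \<open>c(w)\<close> for \<open>c\<close> the
  function of \<open>X\<^sub>i\<close>, the two middle terms are the translates of the potential, and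
  the last term vanishes because \<open>X\<^sub>j w = w X\<^sub>j\<^sub>+\<^sub>n\<close> is not right divisible by \<open>X\<^sub>j\<^sub>+\<^sub>1\<close>. The last claim is
  false for \<open>n = 1\<close>; in that case both sides of the lemma are zero.
\<close>

lemma cocycle_gen_eq_coboundary:
  "c (X i) w = convolution (delta (X i)) potential w - convolution potential (delta (X i)) w"
proof (cases "thompson_length w = 1")
  case True
  then obtain k where w: "w = X k"
    using thompson_length_eq_1 by blast
  show ?thesis
  proof (cases "k = i")
    case True
    then show ?thesis
      using convolution_delta_left[of "X i" potential 1] convolution_delta_right[of potential "X i" 1]
      by (simp add: w cocycle_gen_gen)
  next
    case False
    have "X k \<noteq> X i * v" "X k \<noteq> v * X i" for v
    proof -
      have "v = 1" if "thompson_length (X k) = thompson_length v + 1"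
        using that by simp
      moreover have "X k \<noteq> X i"
        using False right_nf_simps(3) by (metis list.inject)
      ultimately show "X k \<noteq> X i * v" "X k \<noteq> v * X i"
        by (metis add.commute mult_1 mult_1_right thompson_length_simps(2,3))+
    qed
    then show ?thesis
      by (simp add: w cocycle_gen_gen convolution_delta_left_0 convolution_delta_right_0)
  qed
next
  case False
  have "\<forall>\<^sub>F j in sequentially. \<forall>v. w = v * X i \<longrightarrow> c (X j) (X j * v) = potential v"
  proof (cases "\<exists>v. w = v * X i")
    case True
    then obtain v where "w = v * X i" by blast
    then show ?thesis
      using eventually_potential[of v] by simp
  qed simp
  moreover have "\<forall>\<^sub>F j in sequentially. \<forall>v. w = X i * v \<longrightarrow> c (X (j + 1)) (X (j + 1) * v) = potential v"
  proof (cases "\<exists>v. w = X i * v")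
    case True
    then obtain v where "w = X i * v" by blast
    then show ?thesis
      using eventually_potential[of v, THEN eventually_sequentially_seg[THEN iffD2], of 1] by simp
  qed simp
  ultimately have "\<forall>\<^sub>F j in sequentially. (\<forall>v. w = v * X i \<longrightarrow> c (X j) (X j * v) = potential v) \<and>
      (\<forall>v. w = X i * v \<longrightarrow> c (X (j + 1)) (X (j + 1) * v) = potential v) \<and> indices_below j w \<and> i < j"
    using eventually_indices_below[of w] eventually_gt_at_top[of i] by eventually_elim blast
  then obtain j where right: "\<And>v. w = v * X i \<Longrightarrow> c (X j) (X j * v) = potential v"
    and left: "\<And>v. w = X i * v \<Longrightarrow> c (X (j + 1)) (X (j + 1) * v) = potential v"
    and j: "indices_below j w" "i < j"
    using eventually_happens'[OF sequentially_bot] by blast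
  have "convolution (c (X j)) (delta (X i)) (X j * w) = convolution potential (delta (X i)) w"
  proof (cases "\<exists>v. w = v * X i")
    case True
    then obtain v where v: "w = v * X i" by blast
    then show ?thesis
      using right[OF v] by (simp add: convolution_delta_right flip: mult.assoc)
  next
    case False
    then have "X j * w \<noteq> v * X i" for v
      using gen_past_word_right_divisor[OF j] by blast
    with False show ?thesis
      by (simp add: convolution_delta_right_0)
  qed
  moreover have "convolution (delta (X i)) (c (X (j + 1))) (X j * w) = convolution (delta (X i)) potential w"
  proof (cases "\<exists>v. w = X i * v")
    case True
    then obtain v where v: "w = X i * v" by blast
    have "X j * w = X i * (X (j + 1) * v)"
      using thompson_gen_relation[OF j(2)] by (simp add: v flip: mult.assoc)
    then show ?thesis
      using left[OF v] by (simp add: convolution_delta_left v)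
  next
    case False
    then have "X j * w \<noteq> X i * v" for v
      using common_right_multiple[OF _ j(2)] by blast
    with False show ?thesis
      by (simp add: convolution_delta_left_0)
  qed
  moreover have "convolution (c (X i)) (delta (X (j + 1))) (X j * w) = 0"
  proof (rule convolution_delta_right_0, rule notI)
    fix v assume eq: "X j * w = v * X (j + 1)"
    show False
    proof (cases "w = 1")
      case True
      then obtain u where "1 = u * X j"
        using common_left_multiple[of 1 j v "j + 1"] eq by auto
      then have "thompson_length 1 = thompson_length (u * X j)" by simp
      then show False by simp
    next
      case w: False
      then have "thompson_length w > 1"
        using False by (metis less_one linorder_neqE_nat thompson_length_eq_0)
      then show False
        using word_gen_not_right_divisible[of "j + 1" w "j + thompson_length w" v]
          indices_below_mono[OF j(1)] eq gen_past_word[OF j(1)] by simp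
    qed
  qed
  ultimately show ?thesis
    using cocycle_relation[OF j(2), of "X j * w"] by (simp add: convolution_delta_left algebra_simps)
qed

text \<open>
  Only the values of \<open>g\<close> at the finitely many right factors of points in \<open>W\<close> matter, so \<open>g\<close> may be cut
  down to these. Then for large \<open>j\<close> the factorizations of \<open>X\<^sub>j w\<close> that contribute are those of \<open>w\<close>, with \<open>X\<^sub>j\<close>
  prepended to the left factor, and the bound for the function of \<open>X\<^sub>j\<close> applies.
\<close>

lemma potential_bounded:
  assumes W: "finite W"
  shows "(\<Sum>w\<in>W. (cmod (convolution potential (Rep_ell2 g) w))\<^sup>2) \<le> (K * norm g)\<^sup>2"
proof -
  define F where "F = (\<lambda>w :: thompson. {(u, v). u * v = w})"
  \<comment> \<open>the right and the left factors of the points in \<open>W\<close>\<close>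
  define V where "V = snd ` (\<Union>w\<in>W. F w)"
  define U where "U = fst ` (\<Union>w\<in>W. F w)"
  define h where "h = restrict_ell2 V g"
  have "finite (\<Union>w\<in>W. F w)"
    using W by (intro finite_UN_I) (simp_all add: F_def)
  then have fin: "finite U" "finite V"
    unfolding U_def V_def by (rule finite_imageI)+
  have "\<forall>\<^sub>F j in sequentially. (\<forall>w\<in>W. indices_below j w) \<and> (\<forall>v\<in>V. indices_below j v) \<and>
      (\<forall>u\<in>U. c (X j) (X j * u) = potential u)"
    by (intro eventually_conj eventually_ball_finite ballI W fin
        eventually_indices_below eventually_potential)
  then obtain j where j: "\<And>w. w \<in> W \<Longrightarrow> indices_below j w" "\<And>v. v \<in> V \<Longrightarrow> indices_below j v"
    "\<And>u. u \<in> U \<Longrightarrow> c (X j) (X j * u) = potential u"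
    using eventually_happens'[OF sequentially_bot] by blast
  have conv: "convolution potential (Rep_ell2 g) w = convolution (c (X j)) (Rep_ell2 h) (X j * w)"
    if w: "w \<in> W" for w
  proof -
    have uv: "u \<in> U" "v \<in> V" if "(u, v) \<in> F w" for u v
      using that w by (force simp: U_def V_def)+
    have "convolution (c (X j)) (Rep_ell2 h) (X j * w)
        = (\<Sum>(u, v)\<in>(\<lambda>(u, v). (X j * u, v)) ` F w. c (X j) u * Rep_ell2 h v)"
      unfolding convolution_eq_sum
    proof (intro sum.mono_neutral_right ballI)
      show "(\<lambda>(u, v). (X j * u, v)) ` F w \<subseteq> {(u, v). u * v = X j * w}"
        by (auto simp: F_def mult.assoc)
      fix p assume p: "p \<in> {(u, v). u * v = X j * w} - (\<lambda>(u, v). (X j * u, v)) ` F w"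
      obtain u v where [simp]: "p = (u, v)" by force
      have "v \<notin> V"
      proof
        assume "v \<in> V"
        with p obtain u' where "u = X j * u'" "w = u' * v"
          using gen_factorization[OF j(1)[OF w] j(2), of v u] by auto
        then have "p = (\<lambda>(u, v). (X j * u, v)) (u', v)" "(u', v) \<in> F w"
          by (auto simp: F_def)
        with p show False by blast
      qed
      then show "(case p of (u, v) \<Rightarrow> c (X j) u * Rep_ell2 h v) = 0"
        by (simp add: h_def Rep_restrict_ell2)
    qed simp
    also have "\<dots> = (\<Sum>(u, v)\<in>F w. c (X j) (X j * u) * Rep_ell2 h v)"
      by (subst sum.reindex) (auto simp: inj_on_def case_prod_unfold)
    also have "\<dots> = (\<Sum>(u, v)\<in>F w. potential u * Rep_ell2 g v)"
      by (intro sum.cong) (use uv j(3) in \<open>auto simp: h_def Rep_restrict_ell2\<close>)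
    finally show ?thesis
      by (simp add: convolution_eq_sum F_def)
  qed
  have "(\<Sum>w\<in>W. (cmod (convolution potential (Rep_ell2 g) w))\<^sup>2)
      = (\<Sum>w\<in>(*) (X j) ` W. (cmod (convolution (c (X j)) (Rep_ell2 h) w))\<^sup>2)"
    by (subst sum.reindex) (auto simp: inj_on_def conv)
  also have "\<dots> \<le> (K * norm h)\<^sup>2"
    using W by (intro bounded) simp
  also have "\<dots> \<le> (K * norm g)\<^sup>2"
    using nonneg norm_restrict_ell2 by (auto simp: h_def intro!: power_mono mult_left_mono)
  finally show ?thesis .
qed

end

section \<open>Derivations of the Banach algebra\<close>

lemma continuous_derivation_bounded:
  assumes A: "closed_subalgebra A" and D: "D \<in> continuous_derivations A Y"
  obtains K where "K \<ge> 0" "\<And>S. S \<in> A \<Longrightarrow> norm (D S) \<le> K * norm S"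
proof -
  have scale: "D (r *\<^sub>R S) = r *\<^sub>R D S" "r *\<^sub>R S \<in> A" if "S \<in> A" for r S
    using A D that unfolding closed_subalgebra_def continuous_derivations_def
    by (auto simp flip: op_scale_of_real)
  have 0: "0 \<in> A"
    using A by (simp add: closed_subalgebra_def)
  have [simp]: "D 0 = 0"
    using scale(1)[OF 0, of 0] by simp
  have "continuous_on A D"
    using D by (simp add: continuous_derivations_def)
  then obtain d where d: "d > 0" "\<And>S. S \<in> A \<Longrightarrow> norm S < d \<Longrightarrow> norm (D S) < 1"
    using 0 unfolding continuous_on_iff by (metis \<open>D 0 = 0\<close> dist_0_norm dist_commute zero_less_one)
  have "norm (D S) \<le> 2 / d * norm S" if S: "S \<in> A" for S
  proof (cases "S = 0")
    case False
    define r where "r = d / (2 * norm S)"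
    have "norm (r *\<^sub>R S) < d"
      using False d(1) by (simp add: r_def)
    then have "\<bar>r\<bar> * norm (D S) < 1"
      using d(2)[OF scale(2)[OF S]] scale(1)[OF S] by simp
    then show ?thesis
      using False d(1) by (simp add: r_def field_simps)
  qed simp
  with d(1) that[of "2 / d"] show thesis by simp
qed

lemma derivation_cocycle:
  assumes D: "D \<in> continuous_derivations semigroup_banach_algebra semigroup_banach_algebra"
    and K: "K \<ge> 0" "\<And>S. S \<in> semigroup_banach_algebra \<Longrightarrow> norm (D S) \<le> K * norm S"
  shows "bounded_cocycle (\<lambda>s. Rep_ell2 (symbol (D (translation s)))) K"
proof
  note tr = translation_in_semigroup_banach_algebra
  have L: "D (translation s) \<in> left_convolution_algebra" for s :: thompson
    using D tr semigroup_banach_algebra_subset by (auto simp: continuous_derivations_def)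
  fix s t w :: thompson
  have "D (translation (s * t)) = (translation s o\<^sub>L D (translation t)) + (D (translation s) o\<^sub>L translation t)"
    using D tr unfolding translation_mult continuous_derivations_def by blast
  then have "symbol (D (translation (s * t)))
      = symbol (translation s o\<^sub>L D (translation t)) + symbol (D (translation s) o\<^sub>L translation t)"
    by (simp add: symbol_def blinfun.add_left)
  then show "Rep_ell2 (symbol (D (translation (s * t)))) w
      = convolution (delta s) (Rep_ell2 (symbol (D (translation t)))) w
        + convolution (Rep_ell2 (symbol (D (translation s)))) (delta t) w"
    by (simp only: Rep_ell2_simps Rep_symbol_translation_compose Rep_symbol_compose_translation[OF L])
  fix W :: "thompson set" and g assume W: "finite W"
  have *: "(\<Sum>w\<in>W. (cmod (convolution (Rep_ell2 (symbol (D (translation s)))) (Rep_ell2 g) w))\<^sup>2)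
      \<le> (norm (D (translation s) g))\<^sup>2"
    using sum_le_norm_ell2[OF W, of "D (translation s) g"] by (simp add: left_convolution_apply[OF L])
  have "norm (D (translation s)) \<le> K * norm (translation s)"
    by (rule K(2)[OF tr])
  then have "norm (D (translation s)) \<le> K"
    using mult_left_le[OF translation(2) K(1)] by (rule order_trans)
  then have "norm (D (translation s) g) \<le> K * norm g"
    by (intro order_trans[OF norm_blinfun] mult_right_mono) simp_all
  then have "(norm (D (translation s) g))\<^sup>2 \<le> (K * norm g)\<^sup>2"
    by (intro power_mono) simp_all
  with * show "(\<Sum>w\<in>W. (cmod (convolution (Rep_ell2 (symbol (D (translation s)))) (Rep_ell2 g) w))\<^sup>2)
      \<le> (K * norm g)\<^sup>2"
    by (rule order_trans)
qed (fact K(1))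

text \<open>
  The operators on which the two derivations agree form a closed subalgebra. It contains the
  translations, as they are products of translations by generators.
\<close>

lemma derivation_eq_commutator:
  assumes D: "D \<in> continuous_derivations A Y" and A: "closed_subalgebra A"
    and sub: "semigroup_banach_algebra \<subseteq> A" and T: "T \<in> bounded_operators"
    and gen: "\<And>i. D (translation (X i)) = (translation (X i) o\<^sub>L T) - (T o\<^sub>L translation (X i))"
    and S: "S \<in> semigroup_banach_algebra"
  shows "D S = (S o\<^sub>L T) - (T o\<^sub>L S)"
proof -
  define C where "C = {S \<in> A. D S = (S o\<^sub>L T) - (T o\<^sub>L S)}"
  have ops: "A \<subseteq> bounded_operators"
    using A by (simp add: closed_subalgebra_def)
  have mult: "R o\<^sub>L S \<in> C" if "R \<in> C" "S \<in> C" for R S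
  proof -
    have "D (R o\<^sub>L S) = (R o\<^sub>L D S) + (D R o\<^sub>L S)" "R o\<^sub>L S \<in> A"
      using that D A by (auto simp: C_def continuous_derivations_def closed_subalgebra_def)
    with that show ?thesis
      by (auto simp: C_def intro!: blinfun_eqI simp: blinfun.add_left blinfun.diff_left blinfun.diff_right)
  qed
  have "closed_subalgebra C"
    unfolding closed_subalgebra_def
  proof (intro conjI ballI allI)
    show "C \<subseteq> bounded_operators"
      using ops by (auto simp: C_def)
    have "continuous_on A (\<lambda>S. D S - ((S o\<^sub>L T) - (T o\<^sub>L S)))"
      using D by (auto simp: continuous_derivations_def intro!: continuous_intros)
    moreover have "C = A \<inter> (\<lambda>S. D S - ((S o\<^sub>L T) - (T o\<^sub>L S))) -` {0}"
      by (auto simp: C_def)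
    ultimately show "closed C"
      using A by (simp only: closed_subalgebra_def) (intro continuous_closed_preimage; simp)
    show "0 \<in> C"
    proof -
      have "0 \<in> A" "D (0 + 0) = D 0 + D 0"
        using A D by (auto simp only: closed_subalgebra_def continuous_derivations_def)
      then show ?thesis by (simp add: C_def)
    qed
    show "R + S \<in> C" if "R \<in> C" "S \<in> C" for R S
      using that A D by (auto simp: C_def closed_subalgebra_def continuous_derivations_def
          intro!: blinfun_eqI simp: blinfun.bilinear_simps)
    show "op_scale z S \<in> C" if "S \<in> C" for z S
      using that A D T by (auto simp: C_def closed_subalgebra_def continuous_derivations_def
          op_scale_diff op_scale_compose_left op_scale_compose_right)
    show "R o\<^sub>L S \<in> C" if "R \<in> C" "S \<in> C" for R S
      using that by (rule mult)
  qed
  moreover have "translation s \<in> C" for s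
  proof (induction s rule: thompson_induct_left)
    case one
    have tr: "translation 1 \<in> A"
      using sub translation_in_semigroup_banach_algebra by blast
    then have "D (translation 1 o\<^sub>L translation 1)
        = (translation 1 o\<^sub>L D (translation 1)) + (D (translation 1) o\<^sub>L translation 1)"
      using D by (simp add: continuous_derivations_def)
    then have "D id_blinfun = D id_blinfun + D id_blinfun"
      by (simp only: translation_one blinfun_compose_id)
    then have "D id_blinfun = 0"
      by simp
    with tr show ?case
      by (simp add: C_def translation_one blinfun_compose_id)
  next
    case (gen i s)
    have "translation (X i) \<in> C"
      using assms(5) sub translation_in_semigroup_banach_algebra by (auto simp: C_def)
    with gen show ?case
      unfolding translation_mult by (intro mult)
  qed
  ultimately have "semigroup_banach_algebra \<subseteq> C"
    by (rule semigroup_banach_algebra_minimal)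
  with S show ?thesis
    by (auto simp: C_def)
qed

lemma derivation_implemented:
  fixes D :: "thompson ell2_op \<Rightarrow> thompson ell2_op"
  assumes D: "D \<in> continuous_derivations semigroup_banach_algebra semigroup_banach_algebra"
  obtains T where "T \<in> left_convolution_algebra"
    "\<And>S. S \<in> semigroup_banach_algebra \<Longrightarrow> D S = (S o\<^sub>L T) - (T o\<^sub>L S)"
proof -
  note B = closed_subalgebra_semigroup_banach_algebra
  note tr = translation_in_semigroup_banach_algebra
  obtain K where K: "K \<ge> 0" "\<And>S. S \<in> semigroup_banach_algebra \<Longrightarrow> norm (D S) \<le> K * norm S"
    using continuous_derivation_bounded[OF B D] by metis
  interpret bounded_cocycle "\<lambda>s. Rep_ell2 (symbol (D (translation s)))" K
    by (rule derivation_cocycle[OF D K])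
  obtain f T where f: "Rep_ell2 f = potential" and fT: "is_left_convolution f T"
    using ex_left_convolution[OF potential_bounded nonneg] by metis
  have T: "T \<in> left_convolution_algebra" and symT: "symbol T = f"
    using fT symbol_eq by (auto simp: left_convolution_algebra_def)
  have "D (translation (X i)) = (translation (X i) o\<^sub>L T) - (T o\<^sub>L translation (X i))" for i
  proof (rule left_convolution_eqI)
    show "D (translation (X i)) \<in> left_convolution_algebra"
      using D tr semigroup_banach_algebra_subset by (auto simp: continuous_derivations_def)
    show "(translation (X i) o\<^sub>L T) - (T o\<^sub>L translation (X i)) \<in> left_convolution_algebra"
      by (intro closed_subalgebraD(6,8) closed_subalgebra_left_convolution_algebra T
          translation_in_left_convolution_algebra)
    fix w
    have "symbol ((translation (X i) o\<^sub>L T) - (T o\<^sub>L translation (X i)))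
        = symbol (translation (X i) o\<^sub>L T) - symbol (T o\<^sub>L translation (X i))"
      by (simp add: symbol_def blinfun.diff_left)
    then show "Rep_ell2 (symbol (D (translation (X i)))) w
        = Rep_ell2 (symbol ((translation (X i) o\<^sub>L T) - (T o\<^sub>L translation (X i)))) w"
      by (simp only: Rep_ell2_simps Rep_symbol_translation_compose
          Rep_symbol_compose_translation[OF T] symT f cocycle_gen_eq_coboundary)
  qed
  moreover have "T \<in> bounded_operators"
    using T closed_subalgebra_left_convolution_algebra by (auto simp: closed_subalgebra_def)
  ultimately show thesis
    using that[OF T] derivation_eq_commutator[OF D B order_refl] by blast
qed

section \<open>Quotients of complex vector spaces\<close>

text \<open>
  Additivity of the scalar multiplication and \<open>(-1) x = - x\<close> are the laws that computing with cosets
  relies on.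
\<close>

definition complex_subspace :: "(complex \<Rightarrow> 'v \<Rightarrow> 'v) \<Rightarrow> 'v::ab_group_add set \<Rightarrow> bool" where
  "complex_subspace sc V \<longleftrightarrow> (\<forall>c x y. sc c (x + y) = sc c x + sc c y) \<and> (\<forall>x. sc (-1) x = - x) \<and>
    0 \<in> V \<and> (\<forall>x\<in>V. \<forall>y\<in>V. x + y \<in> V) \<and> (\<forall>c. \<forall>x\<in>V. sc c x \<in> V)"

lemma complex_subspaceD:
  assumes "complex_subspace sc V"
  shows "sc c (a + b) = sc c a + sc c b" "0 \<in> V" "x \<in> V \<Longrightarrow> y \<in> V \<Longrightarrow> x + y \<in> V"
    "x \<in> V \<Longrightarrow> sc c x \<in> V" "x \<in> V \<Longrightarrow> - x \<in> V" "x \<in> V \<Longrightarrow> y \<in> V \<Longrightarrow> x - y \<in> V"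
proof -
  show "sc c (a + b) = sc c a + sc c b" "0 \<in> V" "x \<in> V \<Longrightarrow> sc c x \<in> V"
    and add: "x \<in> V \<Longrightarrow> y \<in> V \<Longrightarrow> x + y \<in> V" for c x y
    using assms by (simp_all add: complex_subspace_def)
  have neg: "sc (-1) x = - x" for x
    using assms by (simp add: complex_subspace_def)
  have "x \<in> V \<Longrightarrow> sc (-1) x \<in> V" for x
    using assms unfolding complex_subspace_def by blast
  then show minus: "x \<in> V \<Longrightarrow> - x \<in> V" for x
    by (simp only: neg)
  show "x \<in> V \<Longrightarrow> y \<in> V \<Longrightarrow> x - y \<in> V"
    using add[of x "- y"] minus[of y] by simp
qed

lemma mem_coset_iff: "x \<in> v +o W \<longleftrightarrow> x - v \<in> (W :: 'v::ab_group_add set)"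
proof
  assume "x - v \<in> W"
  then have "v + (x - v) \<in> v +o W"
    by (rule set_plus_intro2)
  then show "x \<in> v +o W" by simp
qed (auto simp: elt_set_plus_def)

lemma coset_eq_iff:
  assumes W: "complex_subspace sc W"
  shows "u +o W = v +o W \<longleftrightarrow> u - v \<in> W"
proof
  assume "u +o W = v +o W"
  moreover have "u \<in> u +o W"
    using complex_subspaceD(2)[OF W] by (simp add: mem_coset_iff)
  ultimately show "u - v \<in> W"
    by (simp add: mem_coset_iff)
next
  assume uv: "u - v \<in> W"
  show "u +o W = v +o W"
  proof (rule set_eqI)
    fix x
    have "x - v \<in> W" if "x - u \<in> W"
      using complex_subspaceD(3)[OF W that uv] by simp
    moreover have "x - u \<in> W" if "x - v \<in> W"
      using complex_subspaceD(6)[OF W that uv] by simp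
    ultimately show "x \<in> u +o W \<longleftrightarrow> x \<in> v +o W"
      unfolding mem_coset_iff by blast
  qed
qed

lemma coset_add:
  assumes W: "complex_subspace sc W"
  shows "(u +o W) + (v +o W) = (u + v) +o W"
proof -
  have "W + W = W"
  proof (intro equalityI subsetI)
    fix x assume "x \<in> W"
    then show "x \<in> W + W"
      using set_plus_intro[OF complex_subspaceD(2)[OF W], of x W] by simp
  qed (elim set_plus_elim, simp add: complex_subspaceD(3)[OF W])
  then show ?thesis
    by (simp only: set_plus_rearrange)
qed

text \<open>
  Adding \<open>W\<close> matters for \<open>c = 0\<close>, where the image of the coset is \<open>{0}\<close>.
\<close>

lemma coset_scale:
  assumes W: "complex_subspace sc W"
  shows "sc c ` (v +o W) + W = sc c v +o W"
proof (intro equalityI subsetI)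
  fix x assume "x \<in> sc c ` (v +o W) + W"
  then obtain y w' where y: "y \<in> v +o W" and w': "w' \<in> W" and x: "x = sc c y + w'"
    by (elim set_plus_elim imageE) blast
  from y have "sc c (y - v) + w' \<in> W"
    unfolding mem_coset_iff by (intro complex_subspaceD(3,4)[OF W] w')
  moreover have "sc c y = sc c (y - v) + sc c v"
    using complex_subspaceD(1)[OF W, of c "y - v" v] by simp
  ultimately show "x \<in> sc c v +o W"
    by (simp add: mem_coset_iff x algebra_simps)
next
  fix x assume "x \<in> sc c v +o W"
  then have "sc c v + (x - sc c v) \<in> sc c ` (v +o W) + W"
    using complex_subspaceD(2)[OF W]
    by (intro set_plus_intro imageI) (simp_all add: mem_coset_iff)
  then show "x \<in> sc c ` (v +o W) + W"
    by simp
qed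

text \<open>
  The isomorphism theorem. The isomorphism sends a coset of \<open>W'\<close> to its preimage under \<open>\<psi>\<close>, which is a
  coset of \<open>W\<close> because the preimage of \<open>W'\<close> is \<open>W\<close>; no choice of representatives is involved.
\<close>

lemma quotient_space_isomorphicI:
  fixes \<psi> :: "'v::ab_group_add \<Rightarrow> 'w::ab_group_add"
  assumes V: "complex_subspace sc V" and W: "complex_subspace sc W"
    and W': "complex_subspace sc' W'"
    and onto: "\<psi> ` V = V'"
    and add: "\<And>u v. u \<in> V \<Longrightarrow> v \<in> V \<Longrightarrow> \<psi> (u + v) = \<psi> u + \<psi> v"
    and scale: "\<And>c v. v \<in> V \<Longrightarrow> \<psi> (sc c v) = sc' c (\<psi> v)"
    and ker: "\<And>v. v \<in> V \<Longrightarrow> \<psi> v \<in> W' \<longleftrightarrow> v \<in> W" and sub: "W \<subseteq> V"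
  shows "cvector_space_isomorphic (quotient_space sc' V' W') (quotient_space sc V W)"
proof -
  define \<phi> where "\<phi> = (\<lambda>U. {v \<in> V. \<psi> v \<in> U})"
  have diff: "\<psi> u - \<psi> v \<in> W' \<longleftrightarrow> u - v \<in> W" if "u \<in> V" "v \<in> V" for u v
  proof -
    have "u - v \<in> V"
      using complex_subspaceD(6)[OF V] that by blast
    then show ?thesis
      using add[of "u - v" v] ker[of "u - v"] that by simp
  qed
  have \<phi>: "\<phi> (\<psi> v +o W') = v +o W" if v: "v \<in> V" for v
  proof (rule set_eqI)
    fix x
    have "x \<in> V" if "x - v \<in> W"
      using complex_subspaceD(3)[OF V _ v, of "x - v"] that sub by auto
    with v diff show "x \<in> \<phi> (\<psi> v +o W') \<longleftrightarrow> x \<in> v +o W"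
      by (auto simp: \<phi>_def mem_coset_iff)
  qed
  have carrier: "(\<lambda>v. v +o W') ` V' = (\<lambda>v. \<psi> v +o W') ` V"
    using onto by auto
  have bij: "bij_betw \<phi> ((\<lambda>v. v +o W') ` V') ((\<lambda>v. v +o W) ` V)"
  proof (rule bij_betw_imageI)
    show "inj_on \<phi> ((\<lambda>v. v +o W') ` V')"
      unfolding carrier
    proof (rule inj_onI, elim imageE, simp only: \<phi>)
      fix u v assume "u \<in> V" "v \<in> V" "u +o W = v +o W"
      then show "\<psi> u +o W' = \<psi> v +o W'"
        by (simp add: coset_eq_iff[OF W] coset_eq_iff[OF W'] diff)
    qed
    show "\<phi> ` (\<lambda>v. v +o W') ` V' = (\<lambda>v. v +o W) ` V"
      unfolding carrier by (simp add: image_image \<phi>)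
  qed
  have \<phi>_add: "\<phi> ((\<psi> u +o W') + (\<psi> v +o W')) = \<phi> (\<psi> u +o W') + \<phi> (\<psi> v +o W')"
    if "u \<in> V" "v \<in> V" for u v
    unfolding coset_add[OF W'] add[OF that, symmetric] \<phi>[OF that(1)] \<phi>[OF that(2)]
      \<phi>[OF complex_subspaceD(3)[OF V that]] coset_add[OF W] ..
  have \<phi>_scale: "\<phi> (sc' c ` (\<psi> v +o W') + W') = sc c ` \<phi> (\<psi> v +o W') + W" if "v \<in> V" for c v
    unfolding coset_scale[OF W'] scale[OF that, symmetric] \<phi>[OF that]
      \<phi>[OF complex_subspaceD(4)[OF V that]] coset_scale[OF W] ..
  show ?thesis
    unfolding cvector_space_isomorphic_def quotient_space_def cvector_space.simps
  proof (intro exI[of _ \<phi>] conjI ballI allI bij; unfold carrier; elim imageE)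
    fix x y u v assume "x = \<psi> u +o W'" "u \<in> V" "y = \<psi> v +o W'" "v \<in> V"
    then show "\<phi> (x + y) = \<phi> x + \<phi> y"
      by (simp only: \<phi>_add)
  next
    fix c x v assume "x = \<psi> v +o W'" "v \<in> V"
    then show "\<phi> (sc' c ` x + W') = sc c ` \<phi> x + W"
      by (simp only: \<phi>_scale)
  qed
qed

section \<open>The first cohomology group\<close>

lemmas compose_bilinear =
  bounded_bilinear.add_left[OF bounded_bilinear_blinfun_compose]
  bounded_bilinear.add_right[OF bounded_bilinear_blinfun_compose]
  bounded_bilinear.diff_left[OF bounded_bilinear_blinfun_compose]
  bounded_bilinear.diff_right[OF bounded_bilinear_blinfun_compose]

text \<open>
  The value outside \<open>A\<close> is the one that represents maps on \<open>A\<close> in \<^const>\<open>continuous_derivations\<close>.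
\<close>

definition commutator_map :: "'a ell2_op set \<Rightarrow> 'a ell2_op \<Rightarrow> 'a ell2_op \<Rightarrow> 'a ell2_op" where
  "commutator_map A T S = (if S \<in> A then (S o\<^sub>L T) - (T o\<^sub>L S) else 0)"

lemma complex_subspace_op_scale:
  assumes "closed_subalgebra A"
  shows "complex_subspace op_scale A"
  using closed_subalgebraD[OF assms] by (simp add: complex_subspace_def op_scale_add)

lemma commutator_map_derivation:
  assumes A: "closed_subalgebra A" and T: "T \<in> bounded_operators"
    and comm: "\<And>S. S \<in> A \<Longrightarrow> (T o\<^sub>L S) - (S o\<^sub>L T) \<in> A"
  shows "commutator_map A T \<in> continuous_derivations A A"
  unfolding continuous_derivations_def
proof (intro CollectI conjI ballI allI impI)
  fix R S and c
  assume R: "R \<in> A"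
  have bounded: "R \<in> bounded_operators"
    using closed_subalgebraD(1)[OF A] R by blast
  show "commutator_map A T R \<in> A"
    using closed_subalgebraD(7)[OF A comm[OF R]] R by (simp add: commutator_map_def)
  show "commutator_map A T (op_scale c R) = op_scale c (commutator_map A T R)"
    using R T closed_subalgebraD(5)[OF A]
    by (simp add: commutator_map_def op_scale_diff op_scale_compose_left op_scale_compose_right)
  assume S: "S \<in> A"
  show "commutator_map A T (R + S) = commutator_map A T R + commutator_map A T S"
    using R S closed_subalgebraD(4)[OF A]
    by (simp add: commutator_map_def compose_bilinear)
  show "commutator_map A T (R o\<^sub>L S) = (R o\<^sub>L commutator_map A T S) + (commutator_map A T R o\<^sub>L S)"
    using R S closed_subalgebraD(6)[OF A]
    by (auto simp: commutator_map_def blinfun.diff_left blinfun.add_left blinfun.diff_right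
        intro!: blinfun_eqI)
next
  have "continuous_on A (\<lambda>S. (S o\<^sub>L T) - (T o\<^sub>L S))"
    by (intro continuous_intros)
  then show "continuous_on A (commutator_map A T)"
    by (rule continuous_on_cong[THEN iffD1, rotated 2]) (simp_all add: commutator_map_def)
qed (simp add: commutator_map_def)

lemma commutator_map_add:
  "commutator_map A (S + T) = commutator_map A S + commutator_map A T"
  by (auto simp: commutator_map_def fun_eq_iff compose_bilinear)

lemma commutator_map_scale:
  assumes "A \<subseteq> bounded_operators"
  shows "commutator_map A (op_scale c T) = (\<lambda>S. op_scale c (commutator_map A T S))"
proof
  fix S
  have "op_scale c (0 :: 'a ell2_op) = 0"
    by (intro blinfun_eqI ell2_eqI) simp
  then show "commutator_map A (op_scale c T) S = op_scale c (commutator_map A T S)"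
    using assms by (auto simp: commutator_map_def op_scale_diff op_scale_compose_left op_scale_compose_right)
qed

lemma derivation_multipliers_subspace:
  "complex_subspace op_scale (derivation_multipliers :: 'a::finite_factorization_monoid ell2_op set)"
proof -
  note B = closed_subalgebraD[OF closed_subalgebra_semigroup_banach_algebra]
  note L = closed_subalgebraD[OF closed_subalgebra_left_convolution_algebra]
  let ?B = "semigroup_banach_algebra :: 'a ell2_op set"
  have "S + T \<in> derivation_multipliers"
    if "S \<in> derivation_multipliers" "T \<in> derivation_multipliers" for S T :: "'a ell2_op"
  proof -
    have "((S + T) o\<^sub>L A) - (A o\<^sub>L (S + T)) = ((S o\<^sub>L A) - (A o\<^sub>L S)) + ((T o\<^sub>L A) - (A o\<^sub>L T))" for A
      by (simp add: compose_bilinear)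
    with that show ?thesis
      by (auto simp: derivation_multipliers_def intro: B(4) L(4))
  qed
  moreover have "op_scale c T \<in> derivation_multipliers"
    if "T \<in> derivation_multipliers" for c and T :: "'a ell2_op"
  proof -
    have "(op_scale c T o\<^sub>L A) - (A o\<^sub>L op_scale c T) = op_scale c ((T o\<^sub>L A) - (A o\<^sub>L T))" if "A \<in> ?B" for A
      using B(1) that by (auto simp: op_scale_diff op_scale_compose_left op_scale_compose_right)
    with that show ?thesis
      by (auto simp: derivation_multipliers_def intro: B(5) L(5))
  qed
  moreover have "(0 :: 'a ell2_op) \<in> derivation_multipliers"
    by (simp add: derivation_multipliers_def B(3) L(3))
  ultimately show ?thesis
    by (simp add: complex_subspace_def op_scale_add)
qed

lemma semigroup_banach_algebra_subset_multipliers: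
  "(semigroup_banach_algebra :: 'a::finite_factorization_monoid ell2_op set) \<subseteq> derivation_multipliers"
proof
  fix T :: "'a ell2_op" assume T: "T \<in> semigroup_banach_algebra"
  then have "(T o\<^sub>L A) - (A o\<^sub>L T) \<in> semigroup_banach_algebra" if "A \<in> semigroup_banach_algebra" for A
    using that by (intro closed_subalgebraD(6,8) closed_subalgebra_semigroup_banach_algebra)
  with T show "T \<in> derivation_multipliers"
    using semigroup_banach_algebra_subset by (auto simp: derivation_multipliers_def)
qed

lemma commutator_map_multiplier_derivation:
  assumes "T \<in> derivation_multipliers"
  shows "commutator_map semigroup_banach_algebra T
    \<in> continuous_derivations semigroup_banach_algebra
        (semigroup_banach_algebra :: 'a::finite_factorization_monoid ell2_op set)"
  using assms closed_subalgebraD(1)[OF closed_subalgebra_left_convolution_algebra]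
  by (intro commutator_map_derivation closed_subalgebra_semigroup_banach_algebra)
    (auto simp: derivation_multipliers_def)

lemma inner_derivations_eq:
  "inner_derivations semigroup_banach_algebra
      (semigroup_banach_algebra :: 'a::finite_factorization_monoid ell2_op set)
    = commutator_map semigroup_banach_algebra ` semigroup_banach_algebra"
  (is "?I = ?c ` ?B")
proof (intro equalityI subsetI)
  fix D assume "D \<in> ?I"
  then obtain T where "T \<in> ?B" "\<And>S. S \<in> ?B \<Longrightarrow> D S = (S o\<^sub>L T) - (T o\<^sub>L S)" "\<And>S. S \<notin> ?B \<Longrightarrow> D S = 0"
    by (auto simp: inner_derivations_def continuous_derivations_def)
  then have "D = ?c T" "T \<in> ?B"
    by (auto simp: commutator_map_def)
  then show "D \<in> ?c ` ?B" by blast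
next
  fix D assume "D \<in> ?c ` ?B"
  then obtain T where T: "T \<in> ?B" "D = ?c T" by blast
  then have "D \<in> continuous_derivations ?B ?B"
    using commutator_map_multiplier_derivation semigroup_banach_algebra_subset_multipliers by blast
  with T show "D \<in> ?I"
    by (auto simp: inner_derivations_def commutator_map_def)
qed

lemma inner_derivations_subspace:
  "complex_subspace (\<lambda>c D S. op_scale c (D S)) (inner_derivations semigroup_banach_algebra
      (semigroup_banach_algebra :: 'a::finite_factorization_monoid ell2_op set))"
proof -
  note B = closed_subalgebraD[OF closed_subalgebra_semigroup_banach_algebra]
  have "0 = commutator_map semigroup_banach_algebra (0 :: 'a ell2_op)"
    by (simp add: commutator_map_def fun_eq_iff)
  then have "(0 :: 'a ell2_op \<Rightarrow> 'a ell2_op)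
      \<in> commutator_map semigroup_banach_algebra ` semigroup_banach_algebra"
    using B(3) by (rule image_eqI)
  moreover have "commutator_map semigroup_banach_algebra S + commutator_map semigroup_banach_algebra T
      \<in> commutator_map semigroup_banach_algebra ` semigroup_banach_algebra"
    if "S \<in> semigroup_banach_algebra" "T \<in> semigroup_banach_algebra" for S T :: "'a ell2_op"
    unfolding commutator_map_add[symmetric] using B(4)[OF that] by (rule imageI)
  moreover have "(\<lambda>S. op_scale c (commutator_map semigroup_banach_algebra T S))
      \<in> commutator_map semigroup_banach_algebra ` semigroup_banach_algebra"
    if "T \<in> semigroup_banach_algebra" for c and T :: "'a ell2_op"
    unfolding commutator_map_scale[OF B(1), symmetric] using B(5)[OF that] by (rule imageI)
  moreover have "(\<lambda>S. op_scale c ((D + E) S)) = (\<lambda>S. op_scale c (D S)) + (\<lambda>S. op_scale c (E S))"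
    for c and D E :: "'a ell2_op \<Rightarrow> 'a ell2_op"
    by (simp add: fun_eq_iff op_scale_add)
  moreover have "(\<lambda>S. op_scale (-1) (D S)) = - D" for D :: "'a ell2_op \<Rightarrow> 'a ell2_op"
    by (simp add: fun_eq_iff)
  ultimately show ?thesis
    unfolding inner_derivations_eq complex_subspace_def by (intro conjI allI ballI; (elim imageE, hypsubst)?)
qed

text \<open>
  If \<open>T\<close> and \<open>T' \<in> B\<close> induce the same derivation, then \<open>T - T'\<close> commutes with all translations and is a
  scalar.
\<close>

lemma commutator_map_inner_iff:
  assumes T: "(T :: thompson ell2_op) \<in> derivation_multipliers"
  shows "commutator_map semigroup_banach_algebra T
      \<in> inner_derivations semigroup_banach_algebra semigroup_banach_algebra
    \<longleftrightarrow> T \<in> semigroup_banach_algebra"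
proof
  let ?B = "semigroup_banach_algebra :: thompson ell2_op set"
  note B = closed_subalgebraD[OF closed_subalgebra_semigroup_banach_algebra]
  assume "commutator_map ?B T \<in> inner_derivations ?B ?B"
  then obtain T' where T': "T' \<in> ?B" and eq: "commutator_map ?B T = commutator_map ?B T'"
    unfolding inner_derivations_eq by blast
  define R where "R = T - T'"
  have R: "R \<in> left_convolution_algebra"
    using T T' semigroup_banach_algebra_subset unfolding R_def derivation_multipliers_def
    by (auto intro!: closed_subalgebraD(8) closed_subalgebra_left_convolution_algebra)
  have "R o\<^sub>L translation (X j) = translation (X j) o\<^sub>L R" for j
  proof -
    have "commutator_map ?B T (translation (X j)) = commutator_map ?B T' (translation (X j))"
      by (simp only: eq)
    then show ?thesis
      using translation_in_semigroup_banach_algebra[of "X j"]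
      by (simp add: commutator_map_def R_def compose_bilinear
          algebra_simps)
  qed
  from commuting_with_translations_scalar[OF R this] obtain z where "R = op_scale z (translation 1)"
    by blast
  then have "R \<in> ?B"
    using translation_in_semigroup_banach_algebra B(5) by blast
  with T' have "T' + R \<in> ?B"
    by (rule B(4))
  then show "T \<in> ?B"
    by (simp add: R_def)
qed (auto simp: inner_derivations_eq)

lemma commutator_map_onto:
  "commutator_map semigroup_banach_algebra ` (derivation_multipliers :: thompson ell2_op set)
    = continuous_derivations semigroup_banach_algebra semigroup_banach_algebra"
proof (intro equalityI subsetI)
  let ?B = "semigroup_banach_algebra :: thompson ell2_op set"
  fix D assume D: "D \<in> continuous_derivations ?B ?B"
  then obtain T where T: "T \<in> left_convolution_algebra"
    and DT: "\<And>S. S \<in> ?B \<Longrightarrow> D S = (S o\<^sub>L T) - (T o\<^sub>L S)"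
    using derivation_implemented by metis
  have "(T o\<^sub>L S) - (S o\<^sub>L T) \<in> ?B" if "S \<in> ?B" for S
  proof -
    have "D S \<in> ?B"
      using D that by (simp add: continuous_derivations_def)
    then have "- D S \<in> ?B"
      by (rule closed_subalgebraD(7)[OF closed_subalgebra_semigroup_banach_algebra])
    then show ?thesis
      by (simp add: DT[OF that])
  qed
  with T have "T \<in> derivation_multipliers"
    by (simp add: derivation_multipliers_def)
  moreover have "D = commutator_map ?B T"
    using D DT by (auto simp: commutator_map_def continuous_derivations_def)
  ultimately show "D \<in> commutator_map ?B ` derivation_multipliers"
    by blast
qed (auto intro: commutator_map_multiplier_derivation)

theorem theorem5p10:
  shows "cvector_space_isomorphic
    (first_cohomology
      (semigroup_banach_algebra :: thompson ell2_op set)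
      (semigroup_banach_algebra :: thompson ell2_op set))
    (quotient_space op_scale
      (derivation_multipliers :: thompson ell2_op set)
      (semigroup_banach_algebra :: thompson ell2_op set))"
  unfolding first_cohomology_def
proof (rule quotient_space_isomorphicI)
  note B = closed_subalgebra_semigroup_banach_algebra
  show "complex_subspace op_scale (semigroup_banach_algebra :: thompson ell2_op set)"
    by (rule complex_subspace_op_scale[OF B])
  show "commutator_map semigroup_banach_algebra (op_scale c T)
      = (\<lambda>S. op_scale c (commutator_map semigroup_banach_algebra T S))" for c and T :: "thompson ell2_op"
    by (rule commutator_map_scale[OF closed_subalgebraD(1)[OF B]])
  show "commutator_map semigroup_banach_algebra T
      \<in> inner_derivations semigroup_banach_algebra semigroup_banach_algebra
      \<longleftrightarrow> T \<in> semigroup_banach_algebra" if "T \<in> derivation_multipliers" for T :: "thompson ell2_op"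
    using that by (rule commutator_map_inner_iff)
qed (rule derivation_multipliers_subspace inner_derivations_subspace commutator_map_onto
    commutator_map_add semigroup_banach_algebra_subset_multipliers)+

end
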